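(* Let $p>2$, let $\Omega\subset\mathbb{R}^n$ be a ball or an annular domain, and let $h\in C^1(\overline\Omega)$ with $h\ge0$. Let $u_0\in X$ be such that the maximal classical solution $u$ of $$u_t-\Delta u=|\nabla u|^p+h(x)\ \text{ in }\Omega\times(0,T),\qquad u=0\ \text{ on }\partial\Omega\times(0,T),\qquad u(\cdot,0)=u_0\ \text{ in }\Omega,$$ has finite existence time $T=T(u_0)<\infty$. Set $\beta=\frac1{p-1}$ and $d_p=(p-1)^{-1/(p-1)}$. Then, for any $\alpha\in\bigl(0,\frac{\beta}{2}\bigr)$, there exists $C>0$ such that $$|\nabla u|\le d_\Omega^{-\beta}\bigl(d_p+C d_\Omega^{\alpha}\bigr)\quad\text{in }\Omega\times(0,T).$$
   Context: $d_\Omega(x)=\operatorname{dist}(x,\partial\Omega)$. $X:=\{u_0\in C^1(\overline\Omega):\ u_0\ge 0,\ u_0=0\text{ on }\partial\Omega\}$. For every $u_0\in X$ the initial-boundary value problem $u_t-\Delta u=|\nabla u|^p+h(x)$ for $x\in\Omega$, $t>0$, with $u=0$ for $x\in\partial\Omega$, $t>0$, and $u(\cdot,0)=u_0$ in $\Omega$, has a unique maximal classical solution $u\ge0$; $T(u_0)\in(0,\infty]$ denotes its existence time. If $T(u_0)<\infty$, then $\lim_{t\to T(u_0)^-}\|\nabla u(\cdot,t)\|_{L^\infty(\Omega)}=\infty$. Neither $u_0$ nor $h$ is assumed radially symmetric. *)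

theory Defs
  imports "HOL-Analysis.Analysis"
begin

definition annular_domain :: "'a::euclidean_space set \<Rightarrow> bool" where
  "annular_domain \<Omega> \<longleftrightarrow> (\<exists>c r R. 0 < r \<and> r < R \<and> \<Omega> = {x. r < dist c x \<and> dist c x < R})"

definition grad :: "('a::euclidean_space \<Rightarrow> real) \<Rightarrow> 'a \<Rightarrow> 'a" where
  "grad f x = (THE D. GDERIV f x :> D)"

text \<open>The trace of the Hessian, the Hessian being the Frechet derivative of the gradient.\<close>

definition laplacian :: "('a::euclidean_space \<Rightarrow> real) \<Rightarrow> 'a \<Rightarrow> real" where
  "laplacian f x = (\<Sum>b\<in>Basis. frechet_derivative (grad f) (at x) b \<bullet> b)"

text \<open>Functions and their derivatives only matter on the set \<open>A\<close>; the values that the total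
  HOL function \<open>g\<close> happens to have on \<open>B - A\<close> are ignored.\<close>

definition extends_continuously ::
    "('a::topological_space \<Rightarrow> 'b::topological_space) \<Rightarrow> 'a set \<Rightarrow> 'a set \<Rightarrow> bool" where
  "extends_continuously g A B \<longleftrightarrow> (\<exists>G. continuous_on B G \<and> (\<forall>z\<in>A. G z = g z))"

definition C1_closure :: "'a::euclidean_space set \<Rightarrow> ('a \<Rightarrow> real) \<Rightarrow> bool" where
  "C1_closure \<Omega> f \<longleftrightarrow>
     continuous_on (closure \<Omega>) f \<and>
     (\<forall>x\<in>\<Omega>. f differentiable (at x)) \<and>
     extends_continuously (grad f) \<Omega> (closure \<Omega>)"

definition initial_data :: "'a::euclidean_space set \<Rightarrow> ('a \<Rightarrow> real) set" where
  "initial_data \<Omega> =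
     {u0. C1_closure \<Omega> u0 \<and> (\<forall>x\<in>closure \<Omega>. 0 \<le> u0 x) \<and> (\<forall>x\<in>frontier \<Omega>. u0 x = 0)}"

text \<open>The class \<open>C\<^sup>1\<^sup>,\<^sup>0(closure \<Omega> \<times> I)\<close>: \<open>u\<close> and its spatial gradient are
  jointly continuous in \<open>(x, t)\<close> up to the boundary of \<open>\<Omega>\<close>.\<close>

definition C10_closure ::
    "'a::euclidean_space set \<Rightarrow> real set \<Rightarrow> ('a \<Rightarrow> real \<Rightarrow> real) \<Rightarrow> bool" where
  "C10_closure \<Omega> I u \<longleftrightarrow>
     continuous_on (closure \<Omega> \<times> I) (\<lambda>(x, t). u x t) \<and>
     (\<forall>x\<in>\<Omega>. \<forall>t\<in>I. (\<lambda>y. u y t) differentiable (at x)) \<and>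
     extends_continuously (\<lambda>(x, t). grad (\<lambda>y. u y t) x) (\<Omega> \<times> I) (closure \<Omega> \<times> I)"

text \<open>The class \<open>C\<^sup>2\<^sup>,\<^sup>1(closure \<Omega> \<times> I)\<close>, for an open interval \<open>I\<close>.\<close>

definition C21_closure ::
    "'a::euclidean_space set \<Rightarrow> real set \<Rightarrow> ('a \<Rightarrow> real \<Rightarrow> real) \<Rightarrow> bool" where
  "C21_closure \<Omega> I u \<longleftrightarrow>
     C10_closure \<Omega> I u \<and>
     (\<forall>x\<in>\<Omega>. \<forall>t\<in>I. grad (\<lambda>y. u y t) differentiable (at x)) \<and>
     (\<forall>b\<in>Basis. extends_continuously
        (\<lambda>(x, t). frechet_derivative (grad (\<lambda>y. u y t)) (at x) b) (\<Omega> \<times> I) (closure \<Omega> \<times> I)) \<and>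
     (\<forall>x\<in>\<Omega>. \<forall>t\<in>I. u x differentiable (at t)) \<and>
     extends_continuously (\<lambda>(x, t). deriv (u x) t) (\<Omega> \<times> I) (closure \<Omega> \<times> I)"

text \<open>Regularity class \<open>C\<^sup>2\<^sup>,\<^sup>1(closure \<Omega> \<times> (0,T)) \<inter> C\<^sup>1\<^sup>,\<^sup>0(closure \<Omega> \<times> [0,T))\<close>.
  Continuity of the gradient up to the boundary is essential: it is what makes the existence
  time of the maximal solution the time of gradient blow-up.  Here \<open>T = \<infinity>\<close> is allowed.\<close>

definition classical_solution ::
    "real \<Rightarrow> 'a::euclidean_space set \<Rightarrow> ('a \<Rightarrow> real) \<Rightarrow> ('a \<Rightarrow> real) \<Rightarrow> ereal \<Rightarrow>
     ('a \<Rightarrow> real \<Rightarrow> real) \<Rightarrow> bool" where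
  "classical_solution p \<Omega> h u0 T u \<longleftrightarrow>
     0 < T \<and>
     C21_closure \<Omega> {t. 0 < t \<and> ereal t < T} u \<and>
     C10_closure \<Omega> {t. 0 \<le> t \<and> ereal t < T} u \<and>
     (\<forall>x\<in>\<Omega>. \<forall>t. 0 < t \<and> ereal t < T \<longrightarrow>
        deriv (u x) t - laplacian (\<lambda>y. u y t) x = norm (grad (\<lambda>y. u y t) x) powr p + h x) \<and>
     (\<forall>x\<in>frontier \<Omega>. \<forall>t. 0 < t \<and> ereal t < T \<longrightarrow> u x t = 0) \<and>
     (\<forall>x\<in>\<Omega>. u x 0 = u0 x)"

definition maximal_classical_solution ::
    "real \<Rightarrow> 'a::euclidean_space set \<Rightarrow> ('a \<Rightarrow> real) \<Rightarrow> ('a \<Rightarrow> real) \<Rightarrow> ereal \<Rightarrow>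
     ('a \<Rightarrow> real \<Rightarrow> real) \<Rightarrow> bool" where
  "maximal_classical_solution p \<Omega> h u0 T u \<longleftrightarrow>
     classical_solution p \<Omega> h u0 T u \<and>
     \<not> (\<exists>T' v. T < T' \<and> classical_solution p \<Omega> h u0 T' v \<and>
           (\<forall>x\<in>closure \<Omega>. \<forall>t. 0 \<le> t \<and> ereal t < T \<longrightarrow> v x t = u x t))"

lemma grad_eqI:
  assumes "GDERIV f x :> D"
  shows "grad f x = D"
  unfolding grad_def
proof (rule the_equality, fact assms)
  fix E assume "GDERIV f x :> E"
  with assms have "(\<lambda>v. v \<bullet> E) = (\<lambda>v. v \<bullet> D)"
    unfolding gderiv_def by (blast intro: has_derivative_unique)
  then have "v \<bullet> E = v \<bullet> D" for v by (rule fun_cong)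
  then show "E = D" using vector_eq_ldot[of E D] by blast
qed

lemma GDERIV_grad:
  assumes "f differentiable (at x)"
  shows "GDERIV f x :> grad f x"
proof -
  obtain f' where f': "(f has_derivative f') (at x)"
    using assms unfolding differentiable_def by blast
  then interpret linear f' by (rule has_derivative_linear)
  have "f' v = v \<bullet> (\<Sum>b\<in>Basis. f' b *\<^sub>R b)" for v
  proof -
    have "f' v = f' (\<Sum>b\<in>Basis. (v \<bullet> b) *\<^sub>R b)" by (simp add: euclidean_representation)
    also have "\<dots> = (\<Sum>b\<in>Basis. (v \<bullet> b) * f' b)" by (simp add: sum scale)
    finally show ?thesis by (simp add: inner_sum_right mult.commute)
  qed
  then have "GDERIV f x :> (\<Sum>b\<in>Basis. f' b *\<^sub>R b)"
    unfolding gderiv_def by (rule has_derivative_eq_rhs[OF f' ext])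
  from this grad_eqI[OF this] show ?thesis by simp
qed

end

theory Submission
  imports Defs
begin

text \<open>
  Fix a unit vector \<open>e\<close> and compare \<open>w = e \<bullet> \<nabla>u\<close>, which formally solves a linear equation with drift
  \<open>p \<bar>\<nabla>u\<bar>\<^sup>p\<^sup>-\<^sup>2 \<nabla>u\<close>, with the barrier \<open>Z = A (2 R - e \<bullet> (x - c)) + F(s)\<close>. Here \<open>s\<close> is the distance to the
  boundary sphere whose inward normal \<open>\<nu>\<close> satisfies \<open>e \<bullet> \<nu> > 0\<close>, and \<open>F\<close> is \<open>d\<^sub>p s\<^sup>-\<^sup>\<beta>\<close> up to a bounded cut-off.
  At a touching point the drift is strong along \<open>e\<close>, so the linear term makes \<open>Z\<close> a strict supersolution
  once \<open>A\<close> is large; near the boundary one also needs \<open>\<nabla>u\<close> to be normal up to a bounded error, which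
  rotation invariance provides. No boundary values are needed where \<open>Z\<close> is infinite. Where \<open>e \<bullet> \<nu> \<le> 0\<close>
  one uses that \<open>u \<ge> 0\<close> vanishes on the boundary. This gives \<open>\<bar>\<nabla>u\<bar> \<le> d\<^sub>p d\<^sup>-\<^sup>\<beta> + C\<close>, and
  \<open>\<alpha> < \<beta>\<close> turns the constant into \<open>C d\<^sup>\<alpha>\<^sup>-\<^sup>\<beta>\<close>.
\<close>

subsection \<open>Calculus and convexity\<close>

text \<open>The power \<open>K * s powr (- \<beta>)\<close> is the slope of the one-dimensional
  steady profile: it satisfies F' = - F^p, hence F'' = - p F^(p-1) F', and so balances the
  linearized equation exactly. Cut-off, curvature, tangential gradient and \<nabla>h only produce
  errors of lower order. They are paid for by the linear part of Z: its gradient - A e contributes -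
  p A |\<nabla>u|^(p-2) (e \<bullet> \<nabla>u), a term of order |\<nabla>u|^(p-1) at a touching
  point. The main obstacle is that no bound for \<nabla>u on the boundary that is uniform up to T is
  available. For each \<tau> < T, however, the gradient is bounded up to time \<tau>, so near its
  own sphere the infinite barrier lies above it in a layer whose width depends on \<tau>. The
  constants A and C do not depend on \<tau>, which is why the estimate survives the limit t ->
  T.\<close>

lemma local_max_second_derivative_nonpos:
  fixes f f' :: "real \<Rightarrow> real"
  assumes "e > 0" and f: "\<And>s. \<bar>s\<bar> < e \<Longrightarrow> (f has_real_derivative f' s) (at s)"
    and f': "(f' has_real_derivative D) (at 0)"
    and max: "\<And>s. \<bar>s\<bar> < e \<Longrightarrow> f s \<le> f 0"
  shows "D \<le> 0"
proof (rule ccontr)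
  assume "\<not> D \<le> 0"
  then have "D > 0" by simp
  have "f' 0 = 0"
    by (rule DERIV_local_max[OF f[of 0] \<open>e > 0\<close>]) (use \<open>e > 0\<close> max in auto)
  \<comment> \<open>\<open>f'\<close> need be differentiable only at \<open>0\<close>. Its sign just
    to the right of \<open>0\<close> and the mean value theorem then contradict the maximum.\<close>
  obtain d where d: "d > 0" "\<And>s. 0 < s \<Longrightarrow> s < d \<Longrightarrow> f' 0 < f' s"
    using DERIV_pos_inc_right[OF f' \<open>D > 0\<close>] by auto
  define s where "s = min d e / 2"
  have s: "0 < s" "s < d" "s < e" using d(1) \<open>e > 0\<close> by (auto simp: s_def)
  obtain z where "0 < z" "z < s" "f s - f 0 = (s - 0) * f' z"
    using MVT2[of 0 s f f'] f s by (metis abs_of_nonneg le_less_trans less_eq_real_def)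
  then have "f s > f 0" using d(2)[of z] s \<open>f' 0 = 0\<close>
    by (smt (verit) mult_pos_pos)
  with max[of s] s show False by simp
qed

text \<open>Each coordinate line through \<open>x0\<close> gives a one-dimensional maximum test. In
  time the maximum is taken over the past only, so that it may sit at the final instant of a closed
  cylinder; this is why only a sign for \<open>D\<close> results.\<close>

lemma parabolic_max_test:
  fixes f :: "'a::euclidean_space \<Rightarrow> real \<Rightarrow> real"
  assumes "e > 0"
    and grad: "\<And>y. y \<in> ball x0 e \<Longrightarrow> ((\<lambda>y. f y t0) has_derivative (\<lambda>v. v \<bullet> G y)) (at y)"
    and hess: "(G has_derivative H) (at x0)"
    and time: "(f x0 has_real_derivative D) (at t0)"
    and max: "\<And>y s. y \<in> ball x0 e \<Longrightarrow> t0 - e < s \<Longrightarrow> s \<le> t0 \<Longrightarrow> f y s \<le> f x0 t0"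
  shows "G x0 = 0" "(\<Sum>b\<in>Basis. H b \<bullet> b) \<le> 0" "D \<ge> 0"
proof -
  have "(\<lambda>v. v \<bullet> G x0) = (\<lambda>v. 0)"
    by (rule differential_zero_maxmin[of x0 "ball x0 e" "\<lambda>y. f y t0"])
      (use assms in \<open>auto intro: grad\<close>)
  then show "G x0 = 0" by (metis inner_eq_zero_iff)
  show "(\<Sum>b\<in>Basis. H b \<bullet> b) \<le> 0"
  proof (rule sum_nonpos)
    fix b :: 'a assume "b \<in> Basis"
    then have nb: "norm b = 1" by simp
    show "H b \<bullet> b \<le> 0"
    proof (rule local_max_second_derivative_nonpos[OF \<open>e > 0\<close>,
        of "\<lambda>s. f (x0 + s *\<^sub>R b) t0" "\<lambda>s. b \<bullet> G (x0 + s *\<^sub>R b)"])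
      fix s :: real assume s: "\<bar>s\<bar> < e"
      then have "x0 + s *\<^sub>R b \<in> ball x0 e" using nb by (simp add: dist_norm)
      note * = grad[OF this]
      have "((\<lambda>s. f (x0 + s *\<^sub>R b) t0) has_derivative (\<lambda>k. (k *\<^sub>R b) \<bullet> G (x0 + s *\<^sub>R b))) (at s)"
        by (rule has_derivative_compose[where f = "\<lambda>s. x0 + s *\<^sub>R b", OF _ *]) (auto intro!: derivative_eq_intros)
      then show "((\<lambda>s. f (x0 + s *\<^sub>R b) t0) has_real_derivative b \<bullet> G (x0 + s *\<^sub>R b)) (at s)"
        by (rule has_derivative_imp_has_field_derivative) simp
      show "f (x0 + s *\<^sub>R b) t0 \<le> f (x0 + 0 *\<^sub>R b) t0"
        using max[of "x0 + s *\<^sub>R b" t0] nb s \<open>e > 0\<close> by (simp add: dist_norm)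
    next
      have "(G has_derivative H) (at (x0 + 0 *\<^sub>R b))" using hess by simp
      then have "((\<lambda>s. G (x0 + s *\<^sub>R b)) has_derivative (\<lambda>k. H (k *\<^sub>R b))) (at 0)"
        by (rule has_derivative_compose[where f = "\<lambda>s. x0 + s *\<^sub>R b", rotated]) (auto intro!: derivative_eq_intros)
      then have "((\<lambda>s. b \<bullet> G (x0 + s *\<^sub>R b)) has_derivative (\<lambda>k. b \<bullet> H (k *\<^sub>R b))) (at 0)"
        by (rule has_derivative_inner_right)
      moreover have "linear H" using hess by (rule has_derivative_linear)
      ultimately show "((\<lambda>s. b \<bullet> G (x0 + s *\<^sub>R b)) has_real_derivative H b \<bullet> b) (at 0)"
        by (intro has_derivative_imp_has_field_derivative) (simp_all add: linear_cmul inner_commute)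
    qed
  qed
  show "D \<ge> 0"
  proof (rule ccontr)
    assume "\<not> D \<ge> 0"
    then obtain d where d: "d > 0" "\<And>k. 0 < k \<Longrightarrow> k < d \<Longrightarrow> f x0 t0 < f x0 (t0 - k)"
      using DERIV_neg_dec_left[OF time] by auto
    define k where "k = min d e / 2"
    have "0 < k" "k < d" "k < e" using d(1) \<open>e > 0\<close> by (auto simp: k_def)
    then show False using d(2)[of k] max[of x0 "t0 - k"] \<open>e > 0\<close> by simp
  qed
qed

section \<open>Convexity inequalities for powers\<close>

lemma powr_tangent_le:
  fixes x y q :: real
  assumes "q \<ge> 1" "x \<ge> 0" "y \<ge> 0"
  shows "x powr q - y powr q \<le> q * x powr (q - 1) * (x - y)"
\<comment> \<open>The tangent line argument lives on the open half-line, so zero arguments are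
  treated apart.\<close>
proof (cases "x = 0 \<or> y = 0")
  case True
  then show ?thesis
  proof
    assume "y = 0"
    have "x powr q \<le> q * x powr q" using assms by (simp add: mult_le_cancel_right1)
    also have "x powr q = x powr (q - 1) * x" using assms by (cases "x = 0") (auto simp: powr_mult_base[symmetric] powr_diff)
    finally show ?thesis using \<open>y = 0\<close> assms \<open>x powr q = x powr (q - 1) * x\<close> by (simp add: mult.assoc)
  qed (use assms in auto)
next
  case False
  then have pos: "x > 0" "y > 0" using assms by auto
  have "(\<lambda>z. z powr q) y - (\<lambda>z. z powr q) x \<ge> q * x powr (q - 1) * (y - x)"
  proof (rule convex_on_imp_above_tangent[where A = "{0<..}"])
    show "convex_on {0<..} (\<lambda>z. z powr q)"
      by (rule powr_convex[OF \<open>q \<ge> 1\<close>])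
    show "((\<lambda>z. z powr q) has_real_derivative q * x powr (q - 1)) (at x within {0<..})"
      using pos by (auto intro!: derivative_eq_intros)
  qed (use pos in \<open>auto simp: interior_open\<close>)
  then show ?thesis by (simp add: algebra_simps)
qed

text \<open>Convexity of the power combined with Cauchy-Schwarz. This linearizes the nonlinearity
  for finite differences: the drift is evaluated at \<open>a\<close>, and the upper bound is what a
  comparison from above requires.\<close>

lemma norm_powr_tangent_le:
  fixes a b :: "'a::real_inner"
  assumes "p \<ge> 2"
  shows "norm a powr p - norm b powr p \<le> p * norm a powr (p - 2) * (a \<bullet> (a - b))"
proof -
  have eq: "norm a powr (p - 1) = norm a powr (p - 2) * norm a"
    by (cases "a = 0") (simp_all add: powr_diff powr_numeral power2_eq_square)
  have "norm a powr p - norm b powr p \<le> p * norm a powr (p - 1) * (norm a - norm b)"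
    using powr_tangent_le[of p "norm a" "norm b"] assms by simp
  also have "\<dots> = p * norm a powr (p - 2) * (norm a * norm a - norm a * norm b)"
    by (simp add: eq algebra_simps)
  also have "\<dots> \<le> p * norm a powr (p - 2) * (a \<bullet> (a - b))"
    using Cauchy_Schwarz_ineq2[of a b] assms
    by (intro mult_left_mono) (auto simp: inner_diff_right power2_norm_eq_inner[symmetric] power2_eq_square)
  finally show ?thesis .
qed

lemma powr_superadditive:
  fixes a b q :: real
  assumes "q \<ge> 1" "a \<ge> 0" "b \<ge> 0"
  shows "a powr q + b powr q \<le> (a + b) powr q"
proof -
  have *: "z powr q = z * z powr (q - 1)" if "z \<ge> 0" for z :: real
    using that by (cases "z = 0") (auto simp: powr_diff)
  have "a powr q + b powr q = a * a powr (q - 1) + b * b powr (q - 1)"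
    using assms * by simp
  also have "\<dots> \<le> a * (a + b) powr (q - 1) + b * (a + b) powr (q - 1)"
    using assms by (intro add_mono mult_left_mono powr_mono2) auto
  also have "\<dots> = (a + b) powr q" using assms *[of "a + b"] by (simp add: algebra_simps)
  finally show ?thesis .
qed

section \<open>Orthogonal maps, their adjoints and the trace\<close>

lemma inner_adjoint_orthogonal:
  fixes Q :: "'a::euclidean_space \<Rightarrow> 'a"
  assumes Q: "orthogonal_transformation Q"
  shows "adjoint Q x \<bullet> adjoint Q y = x \<bullet> y"
proof -
  have lQ: "linear Q" using Q by (rule orthogonal_transformation_linear)
  have "adjoint Q (Q z) = z" for z
    by (metis Q adjoint_works lQ orthogonal_transformation_def vector_eq_ldot)
  then show ?thesis
    using orthogonal_transformation_surj[OF Q] Q unfolding orthogonal_transformation_def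
    by (metis surjD)
qed

text \<open>Expanding in the basis and swapping the sums moves \<open>Q\<close> to its adjoint,
  which is again isometric. It is used to see that the Laplacian commutes with rotations.\<close>

lemma trace_orthogonal_conjugation:
  fixes Q H :: "'a::euclidean_space \<Rightarrow> 'a"
  assumes Q: "orthogonal_transformation Q" and H: "linear H"
  shows "(\<Sum>b\<in>Basis. H (Q b) \<bullet> Q b) = (\<Sum>b\<in>Basis. H b \<bullet> b)"
proof -
  have lQ: "linear Q" using Q by (rule orthogonal_transformation_linear)
  have E: "(\<Sum>b\<in>Basis. H (Q b) \<bullet> Q b)
      = (\<Sum>b\<in>Basis. \<Sum>c\<in>Basis. (Q b \<bullet> c) * (adjoint H (Q b) \<bullet> c))"
  proof (rule sum.cong[OF refl])
    fix b
    have "H (Q b) \<bullet> Q b = Q b \<bullet> adjoint H (Q b)" using adjoint_works[OF H] by simp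
    also have "\<dots> = (\<Sum>c\<in>Basis. (Q b \<bullet> c) * (adjoint H (Q b) \<bullet> c))"
      by (rule euclidean_inner)
    finally show "H (Q b) \<bullet> Q b = (\<Sum>c\<in>Basis. (Q b \<bullet> c) * (adjoint H (Q b) \<bullet> c))" .
  qed
  also have "\<dots> = (\<Sum>c\<in>Basis. \<Sum>b\<in>Basis. (b \<bullet> adjoint Q c) * (b \<bullet> adjoint Q (H c)))"
    by (subst sum.swap) (simp add: adjoint_works[OF lQ] adjoint_works[OF H] inner_commute)
  also have "\<dots> = (\<Sum>c\<in>Basis. adjoint Q c \<bullet> adjoint Q (H c))"
    by (rule sum.cong[OF refl]) (subst euclidean_inner, simp add: inner_commute)
  finally show ?thesis by (simp add: inner_adjoint_orthogonal[OF Q] inner_commute)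
qed

subsection \<open>The radial profile of the barrier\<close>

text \<open>Only \<open>s0\<close> is delicate: there the difference quotient of the glued function
  is dominated by that of \<open>f\<close>, which tends to \<open>0\<close>. It is applied to the
  profile and again to its first derivative.\<close>

lemma has_derivative_glue_zero:
  fixes f f' :: "real \<Rightarrow> real"
  assumes f: "\<And>s. 0 < s \<Longrightarrow> (f has_real_derivative f' s) (at s)"
    and "0 < s" "f s0 = 0" "f' s0 = 0"
  shows "((\<lambda>s. if s < s0 then f s else 0) has_real_derivative (if s < s0 then f' s else 0)) (at s)"
proof -
  consider "s < s0" | "s > s0" | "s = s0" by linarith
  then show ?thesis
  proof cases
    case 1
    have "eventually (\<lambda>t. t < s0) (nhds s)" using 1 by (intro eventually_nhds_in_open[of "{..<s0}", simplified])
    then have ev: "eventually (\<lambda>t. (if t < s0 then f t else 0) = f t) (nhds s)"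
      by eventually_elim simp
    show ?thesis using DERIV_cong_ev[OF refl ev refl] f[OF \<open>0 < s\<close>] 1 by simp
  next
    case 2
    have "eventually (\<lambda>t. t > s0) (nhds s)" using 2 by (intro eventually_nhds_in_open[of "{s0<..}", simplified])
    then have ev: "eventually (\<lambda>t. (if t < s0 then f t else 0) = 0) (nhds s)"
      by eventually_elim simp
    show ?thesis using DERIV_cong_ev[OF refl ev refl] 2 by simp
  next
    case 3
    have "(f has_real_derivative 0) (at s0)" using f[of s0] assms 3 by simp
    then have "((\<lambda>t. (f t - f s0) / (t - s0)) \<longlongrightarrow> 0) (at s0)"
      by (simp add: has_field_derivative_iff)
    then have "((\<lambda>t. ((if t < s0 then f t else 0) - (if s0 < s0 then f s0 else 0)) / (t - s0)) \<longlongrightarrow> 0) (at s0)"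
      by (rule Lim_null_comparison[rotated, OF tendsto_norm_zero])
        (auto simp: assms intro!: always_eventually)
    then show ?thesis using 3 by (simp add: has_field_derivative_iff)
  qed
qed

text \<open>\<open>C0\<close> dominates what the cut-off removes from the pure power and from its
  derivative. Hence \<open>F s + C0\<close> and \<open>C0 - F' s\<close> are bounded below by the
  pure-power expressions, and the identity F'' = - p F^(p-1) F' survives as an inequality.\<close>

lemma barrier_profile:
  fixes p s0 :: real
  assumes "p > 2" "s0 > 0"
  defines "K \<equiv> (p - 1) powr (- 1 / (p - 1))" and "\<beta> \<equiv> 1 / (p - 1)"
  obtains C0 :: real and F F' F'' :: "real \<Rightarrow> real" where "C0 \<ge> 0"
    "\<And>s. s > 0 \<Longrightarrow> (F has_real_derivative F' s) (at s)"
    "\<And>s. s > 0 \<Longrightarrow> (F' has_real_derivative F'' s) (at s)"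
    "continuous_on {0<..} F''"
    "\<And>s. s > 0 \<Longrightarrow> 0 \<le> F s"
    "\<And>s. s > 0 \<Longrightarrow> F' s \<le> 0"
    "\<And>s. s > 0 \<Longrightarrow> F'' s \<le> p * (F s + C0) powr (p - 1) * (C0 - F' s)"
    "\<And>s. s > 0 \<Longrightarrow> F s \<le> K * s powr (- \<beta>)"
    "\<And>s. s > 0 \<Longrightarrow> K * s powr (- \<beta>) \<le> F s + C0"
    "\<And>s. s \<ge> s0 \<Longrightarrow> F s = 0"
proof -
  have \<beta>: "\<beta> > 0" using assms by (simp add: \<beta>_def)
  have K: "K > 0" using assms by (simp add: K_def)
  have p\<beta>: "p * \<beta> = \<beta> + 1" "\<beta> * (p - 1) = 1" using assms by (auto simp: \<beta>_def field_simps)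
  have Kq: "K powr (p - 1) = \<beta>"
  proof -
    have "K powr (p - 1) = (p - 1) powr (- 1 / (p - 1) * (p - 1))" unfolding K_def by (rule powr_powr)
    also have "- 1 / (p - 1) * (p - 1) = -1" using assms by simp
    finally show ?thesis using assms by (simp add: \<beta>_def powr_minus_divide)
  qed
  \<comment> \<open>Subtracting the second-order Taylor polynomial at \<open>s0\<close> makes the cut-off profile twice
    continuously differentiable.\<close>
  define \<phi> where "\<phi> s = K * (s powr (-\<beta>) - s0 powr (-\<beta>) + \<beta> * s0 powr (-\<beta>-1) * (s - s0)
     - \<beta> * (\<beta> + 1) / 2 * s0 powr (-\<beta>-2) * (s - s0)\<^sup>2)" for s
  define \<phi>1 where "\<phi>1 s = K * (- \<beta> * s powr (-\<beta>-1) + \<beta> * s0 powr (-\<beta>-1)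
     - \<beta> * (\<beta> + 1) * s0 powr (-\<beta>-2) * (s - s0))" for s
  define \<phi>2 where "\<phi>2 s = K * \<beta> * (\<beta> + 1) * (s powr (-\<beta>-2) - s0 powr (-\<beta>-2))" for s
  have d1: "(\<phi> has_real_derivative \<phi>1 s) (at s)" if "0 < s" for s
    unfolding \<phi>_def[abs_def] \<phi>1_def using that
    by (auto intro!: derivative_eq_intros simp: field_simps)
  have d2: "(\<phi>1 has_real_derivative \<phi>2 s) (at s)" if "0 < s" for s
    unfolding \<phi>1_def[abs_def] \<phi>2_def using that
    by (auto intro!: derivative_eq_intros simp: algebra_simps)
  have z: "\<phi> s0 = 0" "\<phi>1 s0 = 0" "\<phi>2 s0 = 0" by (simp_all add: \<phi>_def \<phi>1_def \<phi>2_def)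
  define F where "F s = (if s < s0 then \<phi> s else 0)" for s
  define F1 where "F1 s = (if s < s0 then \<phi>1 s else 0)" for s
  define F2 where "F2 s = (if s < s0 then \<phi>2 s else 0)" for s
  have D1: "(F has_real_derivative F1 s) (at s)" if "0 < s" for s
    using has_derivative_glue_zero[OF d1 that z(1) z(2)] by (simp add: F_def[abs_def] F1_def)
  have D2: "(F1 has_real_derivative F2 s) (at s)" if "0 < s" for s
    using has_derivative_glue_zero[OF d2 that z(2) z(3)] by (simp add: F1_def[abs_def] F2_def)
  \<comment> \<open>\<open>\<phi>2\<close> decreases through \<open>0\<close> at \<open>s0\<close>,
    so cutting it off means taking the positive part. Continuity and the sign of the second
    derivative follow together.\<close>
  have F2e: "F2 s = max 0 (\<phi>2 s)" if "0 < s" for s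
  proof (cases "s < s0")
    case True
    then have "s0 powr (-\<beta>-2) \<le> s powr (-\<beta>-2)"
      using that \<beta> by (intro powr_mono2') auto
    then show ?thesis using True K \<beta> by (simp add: F2_def \<phi>2_def)
  next
    case False
    then have "s powr (-\<beta>-2) \<le> s0 powr (-\<beta>-2)"
      using assms(1,2) \<beta> by (intro powr_mono2') auto
    then have "\<phi>2 s \<le> 0" using K \<beta> unfolding \<phi>2_def by (intro mult_nonneg_nonpos) auto
    then show ?thesis using False by (simp add: F2_def)
  qed
  have cont: "continuous_on {0<..} F2"
  proof (rule continuous_on_eq)
    show "continuous_on {0<..} (\<lambda>s. max 0 (\<phi>2 s))"
      unfolding \<phi>2_def by (auto intro!: continuous_intros)
  qed (use F2e in auto)
  have F1n: "F1 s \<le> 0" if "0 < s" for s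
  proof (cases "s < s0")
    case True
    have "F1 s \<le> F1 s0"
    proof (rule DERIV_nonneg_imp_nondecreasing[where f = F1])
      show "\<exists>y. (F1 has_real_derivative y) (at x) \<and> 0 \<le> y" if "s \<le> x" for x
        using D2[of x] F2e[of x] \<open>0 < s\<close> that by (intro exI[of _ "F2 x"]) auto
    qed (use True in simp)
    then show ?thesis by (simp add: F1_def)
  qed (simp add: F1_def)
  have Fp: "0 \<le> F s" if "0 < s" for s
  proof (cases "s < s0")
    case True
    have "F s \<ge> F s0"
    proof (rule DERIV_nonpos_imp_nonincreasing[where f = F])
      show "\<exists>y. (F has_real_derivative y) (at x) \<and> y \<le> 0" if "s \<le> x" for x
        using D1[of x] F1n[of x] \<open>0 < s\<close> that by (intro exI[of _ "F1 x"]) auto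
    qed (use True in simp)
    then show ?thesis by (simp add: F_def)
  qed (simp add: F_def)
  define a0 where "a0 = s0 powr (-\<beta>)"
  define a1 where "a1 = \<beta> * s0 powr (-\<beta>-1)"
  define a2 where "a2 = \<beta> * (\<beta> + 1) * s0 powr (-\<beta>-2)"
  have a: "a0 \<ge> 0" "a1 \<ge> 0" "a2 \<ge> 0" using \<beta> by (auto simp: a0_def a1_def a2_def)
  \<comment> \<open>Sum of two budgets: \<open>a0 + a1 * s0 + a2 * s0\<^sup>2\<close> covers the
    loss in \<open>F\<close>, and \<open>a1 + a2 * s0\<close> the loss in its derivative.\<close>
  define C0 where "C0 = K * (a0 + a1 * (1 + s0) + a2 * (s0 + s0\<^sup>2))"
  have C0: "C0 \<ge> 0" using a K assms(1,2) by (auto simp: C0_def)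
  have up: "F s \<le> K * s powr (- \<beta>)" if "0 < s" for s
  proof (cases "s < s0")
    case True
    have "a1 * (s - s0) \<le> 0" using True a by (intro mult_nonneg_nonpos) auto
    moreover have "0 \<le> a2 / 2 * (s - s0)\<^sup>2" using a by simp
    ultimately have "s powr (-\<beta>) - a0 + a1 * (s - s0) - a2 / 2 * (s - s0)\<^sup>2 \<le> s powr (-\<beta>)"
      using a by linarith
    then have "K * (s powr (-\<beta>) - a0 + a1 * (s - s0) - a2 / 2 * (s - s0)\<^sup>2) \<le> K * s powr (-\<beta>)"
      using K by (intro mult_left_mono) auto
    then show ?thesis using True by (simp add: F_def \<phi>_def a0_def a1_def a2_def)
  qed (use K in \<open>simp add: F_def\<close>)
  have lo: "K * s powr (- \<beta>) \<le> F s + C0" if "0 < s" for s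
  proof (cases "s < s0")
    case True
    have "a1 * (s0 - s) \<le> a1 * (1 + s0)" using that a True by (intro mult_left_mono) auto
    moreover have "a2 / 2 * (s - s0)\<^sup>2 \<le> a2 * (s0 + s0\<^sup>2)"
    proof (rule mult_mono)
      have "(s0 - s)\<^sup>2 \<le> s0\<^sup>2" using that True by (intro power_mono) auto
      then show "(s - s0)\<^sup>2 \<le> s0 + s0\<^sup>2" using assms(1,2) by (simp add: power2_commute)
    qed (use a in auto)
    ultimately have "s powr (-\<beta>) \<le> (s powr (-\<beta>) - a0 + a1 * (s - s0) - a2 / 2 * (s - s0)\<^sup>2)
      + (a0 + a1 * (1 + s0) + a2 * (s0 + s0\<^sup>2))"
      using a by (simp add: algebra_simps)
    then have "K * s powr (-\<beta>) \<le> K * ((s powr (-\<beta>) - a0 + a1 * (s - s0) - a2 / 2 * (s - s0)\<^sup>2)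
      + (a0 + a1 * (1 + s0) + a2 * (s0 + s0\<^sup>2)))"
      using K by (intro mult_left_mono) auto
    then have "K * s powr (-\<beta>) \<le> K * (s powr (-\<beta>) - a0 + a1 * (s - s0) - a2 / 2 * (s - s0)\<^sup>2) + C0"
      unfolding C0_def by (subst (asm) distrib_left)
    then show ?thesis using True by (simp add: F_def \<phi>_def a0_def a1_def a2_def)
  next
    case False
    then have "s powr (-\<beta>) \<le> a0" unfolding a0_def using assms(1,2) \<beta> by (intro powr_mono2') auto
    also have "a0 \<le> a0 + a1 * (1 + s0) + a2 * (s0 + s0\<^sup>2)" using a assms(1,2) by auto
    finally show ?thesis using False K by (simp add: F_def C0_def)
  qed
  have lo1: "K * \<beta> * s powr (- \<beta> - 1) \<le> C0 - F1 s" if "0 < s" "s < s0" for s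
  proof -
    have "s0 - s \<le> s0 + s0\<^sup>2" using that zero_le_power2[of s0] by linarith
    then have "a2 * (s0 - s) \<le> a2 * (s0 + s0\<^sup>2)" using a by (intro mult_left_mono) auto
    moreover have "a1 \<le> a1 * (1 + s0)" using a assms(1,2) by (simp add: algebra_simps)
    ultimately have "a1 - a2 * (s - s0) \<le> a0 + a1 * (1 + s0) + a2 * (s0 + s0\<^sup>2)"
      using a by (simp add: algebra_simps)
    then have "K * (a1 - a2 * (s - s0)) \<le> C0" unfolding C0_def using K by (intro mult_left_mono) auto
    then show ?thesis using that by (simp add: F1_def \<phi>1_def a1_def a2_def algebra_simps)
  qed
  have main: "F2 s \<le> p * (F s + C0) powr (p - 1) * (C0 - F1 s)" if "0 < s" for s
  proof (cases "s < s0")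
    case True
    \<comment> \<open>For the pure power, F^(p-1) = \<beta> / s; then
      \<open>p * \<beta> = \<beta> + 1\<close> matches the coefficient of its second
      derivative.\<close>
    have "(K * s powr (-\<beta>)) powr (p - 1) = \<beta> * s powr (-1)"
      using K that p\<beta> by (simp add: powr_mult Kq powr_powr)
    then have e: "p * (K * s powr (-\<beta>)) powr (p - 1) * (K * \<beta> * s powr (-\<beta>-1))
        = K * \<beta> * (p * \<beta>) * (s powr (-1) * s powr (-\<beta>-1))" by simp
    also have "s powr (-1) * s powr (-\<beta>-1) = s powr (-\<beta>-2)"
      by (simp only: powr_add[symmetric]) (rule arg_cong[where f = "\<lambda>z. s powr z"], simp)
    finally have e: "p * (K * s powr (-\<beta>)) powr (p - 1) * (K * \<beta> * s powr (-\<beta>-1))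
        = K * \<beta> * (\<beta> + 1) * s powr (-\<beta>-2)" by (simp add: p\<beta>)
    have "F2 s \<le> K * \<beta> * (\<beta> + 1) * s powr (-\<beta>-2)"
      using True K \<beta> by (simp add: F2_def \<phi>2_def)
    also have "\<dots> = p * (K * s powr (-\<beta>)) powr (p - 1) * (K * \<beta> * s powr (-\<beta>-1))" by (simp add: e)
    also have "\<dots> \<le> p * (F s + C0) powr (p - 1) * (C0 - F1 s)"
      using assms(1,2) K \<beta> lo[OF that] lo1[OF that True]
      by (intro mult_mono powr_mono2) auto
    finally show ?thesis .
  next
    case False
    then show ?thesis using C0 assms(1,2) by (simp add: F2_def F1_def)
  qed
  show thesis
    by (rule that[of C0 F F1 F2])
      (use C0 D1 D2 cont Fp F1n main up lo in \<open>auto simp: F_def F1_def\<close>)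
qed

subsection \<open>Comparison for a classical solution\<close>

lemma bounded_gradient_difference_le:
  fixes f :: "'a::euclidean_space \<Rightarrow> real" and \<gamma> \<gamma>' :: "real \<Rightarrow> 'a"
  assumes "0 \<le> \<theta>"
    and \<gamma>: "\<And>s. 0 \<le> s \<Longrightarrow> s \<le> \<theta> \<Longrightarrow> (\<gamma> has_vector_derivative \<gamma>' s) (at s)"
    and f: "\<And>s. 0 \<le> s \<Longrightarrow> s \<le> \<theta> \<Longrightarrow> (f has_derivative (\<lambda>v. v \<bullet> G (\<gamma> s))) (at (\<gamma> s))"
    and B: "\<And>s. 0 \<le> s \<Longrightarrow> s \<le> \<theta> \<Longrightarrow> \<gamma>' s \<bullet> G (\<gamma> s) \<le> B"
  shows "f (\<gamma> \<theta>) - f (\<gamma> 0) \<le> B * \<theta>"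
proof (cases "\<theta> = 0")
  case False
  have "((\<lambda>s. f (\<gamma> s)) has_real_derivative \<gamma>' s \<bullet> G (\<gamma> s)) (at s)" if "0 \<le> s" "s \<le> \<theta>" for s
  proof (rule has_derivative_imp_has_field_derivative)
    show "((\<lambda>s. f (\<gamma> s)) has_derivative (\<lambda>k. (k *\<^sub>R \<gamma>' s) \<bullet> G (\<gamma> s))) (at s)"
      using has_derivative_compose[OF \<gamma>[OF that, unfolded has_vector_derivative_def] f[OF that]] .
  qed simp
  then obtain z where "0 < z" "z < \<theta>" "f (\<gamma> \<theta>) - f (\<gamma> 0) = (\<theta> - 0) * (\<gamma>' z \<bullet> G (\<gamma> z))"
    using MVT2[of 0 \<theta> "\<lambda>s. f (\<gamma> s)" "\<lambda>s. \<gamma>' s \<bullet> G (\<gamma> s)"] False \<open>0 \<le> \<theta>\<close> by auto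
  then show ?thesis using B[of z] mult_left_mono[of "\<gamma>' z \<bullet> G (\<gamma> z)" B \<theta>] \<open>0 \<le> \<theta>\<close>
    by (simp add: mult.commute)
qed simp

text \<open>For orthonormal \<open>w\<close>, \<open>v\<close> this is the rotation by \<theta> in
  their plane, from \<open>w\<close> towards \<open>v\<close>, and the identity on the orthogonal
  complement. Writing it as a correction of \<open>y\<close> avoids completing \<open>w\<close>,
  \<open>v\<close> to a basis.\<close>

definition plane_rotation :: "'a::euclidean_space \<Rightarrow> 'a \<Rightarrow> real \<Rightarrow> 'a \<Rightarrow> 'a" where
  "plane_rotation w v \<theta> y = y + ((cos \<theta> - 1) * (y \<bullet> w) - sin \<theta> * (y \<bullet> v)) *\<^sub>R w
     + (sin \<theta> * (y \<bullet> w) + (cos \<theta> - 1) * (y \<bullet> v)) *\<^sub>R v"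

lemma plane_rotation_0 [simp]: "plane_rotation w v 0 y = y"
  by (simp add: plane_rotation_def)

lemma orthogonal_transformation_plane_rotation:
  assumes "norm w = 1" "norm v = 1" "w \<bullet> v = 0"
  shows "orthogonal_transformation (plane_rotation w v \<theta>)"
  unfolding orthogonal_transformation
proof
  show "linear (plane_rotation w v \<theta>)"
    by (rule linearI) (simp_all add: plane_rotation_def algebra_simps)
  have n: "w \<bullet> w = 1" "v \<bullet> v = 1" "v \<bullet> w = 0"
    using assms by (simp_all add: dot_square_norm inner_commute)
  show "\<forall>y. norm (plane_rotation w v \<theta> y) = norm y"
  proof
    fix y
    define a b C S where "a = y \<bullet> w" and "b = y \<bullet> v" and "C = cos \<theta>" and "S = sin \<theta>"
    have ab: "y \<bullet> w = a" "w \<bullet> y = a" "y \<bullet> v = b" "v \<bullet> y = b"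
      by (simp_all add: a_def b_def inner_commute)
    have CS: "C\<^sup>2 + S\<^sup>2 = 1" by (simp add: C_def S_def)
    define A B where "A = (C - 1) * a - S * b" and "B = S * a + (C - 1) * b"
    have e: "plane_rotation w v \<theta> y = y + A *\<^sub>R w + B *\<^sub>R v"
      by (simp add: plane_rotation_def A_def B_def a_def b_def C_def S_def)
    have "(y + A *\<^sub>R w + B *\<^sub>R v) \<bullet> (y + A *\<^sub>R w + B *\<^sub>R v)
      = y \<bullet> y + 2 * A * a + 2 * B * b + A\<^sup>2 + B\<^sup>2"
      by (simp add: inner_add_left inner_add_right n assms(3) ab power2_eq_square algebra_simps)
    also have "\<dots> = y \<bullet> y + (a\<^sup>2 + b\<^sup>2) * (C\<^sup>2 + S\<^sup>2 - 1)"
      unfolding A_def B_def by (simp add: power2_eq_square algebra_simps)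
    finally show "norm (plane_rotation w v \<theta> y) = norm y"
      by (simp add: e CS norm_eq_sqrt_inner)
  qed
qed

lemma plane_rotation_has_vector_derivative:
  "((\<lambda>\<theta>. plane_rotation w v \<theta> y) has_vector_derivative
     (- sin \<theta> * (y \<bullet> w) - cos \<theta> * (y \<bullet> v)) *\<^sub>R w + (cos \<theta> * (y \<bullet> w) - sin \<theta> * (y \<bullet> v)) *\<^sub>R v) (at \<theta>)"
  unfolding plane_rotation_def
  by (auto intro!: derivative_eq_intros simp: has_vector_derivative_def algebra_simps)

text \<open>The functions \<open>g\<close>, \<open>H\<close> and \<open>D\<close> stand for the spatial gradient, the Hessian and the time
  derivative of \<open>u\<close>, and \<open>gh\<close> for the gradient of \<open>h\<close>.\<close>

locale viscous_hj =
  fixes p T Lh K0 :: real and \<Omega> :: "'a::euclidean_space set"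
    and h :: "'a \<Rightarrow> real" and u :: "'a \<Rightarrow> real \<Rightarrow> real"
    and gh :: "'a \<Rightarrow> 'a" and g :: "'a \<Rightarrow> real \<Rightarrow> 'a"
    and H :: "'a \<Rightarrow> real \<Rightarrow> 'a \<Rightarrow> 'a" and D :: "'a \<Rightarrow> real \<Rightarrow> real"
  assumes p: "p > 2" and T: "T > 0" and open_\<Omega>: "open \<Omega>" and bounded_\<Omega>: "bounded \<Omega>"
    and cont_u: "continuous_on (closure \<Omega> \<times> {0..<T}) (\<lambda>(x, t). u x t)"
    and u_grad: "\<And>x t. x \<in> \<Omega> \<Longrightarrow> 0 \<le> t \<Longrightarrow> t < T \<Longrightarrow>
      ((\<lambda>y. u y t) has_derivative (\<lambda>v. v \<bullet> g x t)) (at x)"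
    and g_ext: "extends_continuously (\<lambda>(x, t). g x t) (\<Omega> \<times> {0..<T}) (closure \<Omega> \<times> {0..<T})"
    and g_hess: "\<And>x t. x \<in> \<Omega> \<Longrightarrow> 0 < t \<Longrightarrow> t < T \<Longrightarrow> ((\<lambda>y. g y t) has_derivative H x t) (at x)"
    and u_time: "\<And>x t. x \<in> \<Omega> \<Longrightarrow> 0 < t \<Longrightarrow> t < T \<Longrightarrow> (u x has_real_derivative D x t) (at t)"
    and pde: "\<And>x t. x \<in> \<Omega> \<Longrightarrow> 0 < t \<Longrightarrow> t < T \<Longrightarrow>
      D x t = (\<Sum>b\<in>Basis. H x t b \<bullet> b) + norm (g x t) powr p + h x"
    and bc: "\<And>x t. x \<in> frontier \<Omega> \<Longrightarrow> 0 < t \<Longrightarrow> t < T \<Longrightarrow> u x t = 0"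
    and h_grad: "\<And>x. x \<in> \<Omega> \<Longrightarrow> (h has_derivative (\<lambda>v. v \<bullet> gh x)) (at x)"
    and gh_bound: "\<And>x. x \<in> \<Omega> \<Longrightarrow> norm (gh x) \<le> Lh"
    and h_nonneg: "\<And>x. x \<in> \<Omega> \<Longrightarrow> 0 \<le> h x"
    and u0_nonneg: "\<And>x. x \<in> \<Omega> \<Longrightarrow> 0 \<le> u x 0"
    and g0_bound: "\<And>x. x \<in> \<Omega> \<Longrightarrow> norm (g x 0) \<le> K0"
    and Lh: "0 \<le> Lh" and K0: "0 \<le> K0"
begin

section \<open>Compactness of the space-time cylinder and values on its boundary\<close>

lemma compact_cylinder: "compact (closure \<Omega> \<times> {0..\<tau>::real})"
  using bounded_\<Omega> by (intro compact_Times) (auto simp: compact_closure)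

lemma gradient_extension:
  assumes "\<tau> < T"
  obtains G where "continuous_on (closure \<Omega> \<times> {0..\<tau>}) G"
    "\<And>x t. x \<in> \<Omega> \<Longrightarrow> 0 \<le> t \<Longrightarrow> t \<le> \<tau> \<Longrightarrow> G (x, t) = g x t"
proof -
  obtain G where G: "continuous_on (closure \<Omega> \<times> {0..<T}) G" "\<forall>z\<in>\<Omega> \<times> {0..<T}. G z = (\<lambda>(x, t). g x t) z"
    using g_ext unfolding extends_continuously_def by auto
  have "closure \<Omega> \<times> {0..\<tau>} \<subseteq> closure \<Omega> \<times> {0..<T}" using assms by auto
  then show thesis using that[OF continuous_on_subset[OF G(1)]] G(2) assms by auto
qed

text \<open>The continuous extension lives on a compact cylinder. Uniformity up to the boundary
  gives the convergence of difference quotients and the control of normal derivatives near a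
  sphere.\<close>

lemma gradient_uniformly_continuous:
  assumes "\<tau> < T"
  shows "uniformly_continuous_on (\<Omega> \<times> {0..\<tau>}) (\<lambda>(x, t). g x t)"
proof -
  obtain G where G: "continuous_on (closure \<Omega> \<times> {0..\<tau>}) G"
    "\<And>x t. x \<in> \<Omega> \<Longrightarrow> 0 \<le> t \<Longrightarrow> t \<le> \<tau> \<Longrightarrow> G (x, t) = g x t"
    using gradient_extension[OF assms] by blast
  have "uniformly_continuous_on (closure \<Omega> \<times> {0..\<tau>}) G"
    by (rule compact_uniformly_continuous[OF G(1) compact_cylinder])
  moreover have "\<Omega> \<times> {0..\<tau>} \<subseteq> closure \<Omega> \<times> {0..\<tau>}" using closure_subset[of \<Omega>] by auto
  ultimately have "uniformly_continuous_on (\<Omega> \<times> {0..\<tau>}) G"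
    unfolding uniformly_continuous_on_def by (meson subsetD)
  then show ?thesis unfolding uniformly_continuous_on_def by (auto simp: G(2))
qed

text \<open>\<open>M\<close> may grow with \<tau>. It only serves to choose the width of a boundary
  layer and never enters the final constant.\<close>

lemma gradient_bounded:
  assumes "\<tau> < T"
  obtains M where "\<And>x t. x \<in> \<Omega> \<Longrightarrow> 0 \<le> t \<Longrightarrow> t \<le> \<tau> \<Longrightarrow> norm (g x t) \<le> M"
proof -
  obtain G where G: "continuous_on (closure \<Omega> \<times> {0..\<tau>}) G"
    "\<And>x t. x \<in> \<Omega> \<Longrightarrow> 0 \<le> t \<Longrightarrow> t \<le> \<tau> \<Longrightarrow> G (x, t) = g x t"
    using gradient_extension[OF assms] by blast
  have "bounded (G ` (closure \<Omega> \<times> {0..\<tau>}))"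
    by (intro compact_imp_bounded compact_continuous_image[OF G(1)] compact_cylinder)
  then obtain M where M: "\<And>z. z \<in> closure \<Omega> \<times> {0..\<tau>} \<Longrightarrow> norm (G z) \<le> M"
    by (auto simp: bounded_iff)
  show thesis
  proof (rule that[of M])
    fix x t assume "x \<in> \<Omega>" "0 \<le> t" "t \<le> \<tau>"
    then show "norm (g x t) \<le> M" using M[of "(x, t)"] G(2)[of x t] closure_subset[of \<Omega>] by auto
  qed
qed

text \<open>The boundary condition is given for positive times; continuity in time carries it to
  \<open>t = 0\<close>.\<close>

lemma initial_boundary_value: "u x 0 = 0" if "x \<in> frontier \<Omega>"
proof -
  have "x \<in> closure \<Omega>" using that by (simp add: frontier_def)
  then have "continuous_on {0..<T} (\<lambda>t. (\<lambda>(x, t). u x t) (x, t))"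
    by (intro continuous_on_compose2[OF cont_u]) (auto intro!: continuous_intros)
  then have "((\<lambda>t. u x t) \<longlongrightarrow> u x 0) (at 0 within {0..<T})"
    using T by (auto simp: continuous_on_def)
  then have "((\<lambda>t. u x t) \<longlongrightarrow> u x 0) (at 0 within {0<..<T})"
    by (rule tendsto_within_subset) auto
  moreover have "((\<lambda>t. u x t) \<longlongrightarrow> 0) (at 0 within {0<..<T})"
    by (rule tendsto_eventually) (auto simp: eventually_at_filter bc[OF that])
  moreover have "at 0 within {0<..<T} \<noteq> bot" using T
    by (simp add: at_within_eq_bot_iff)
  ultimately show ?thesis using tendsto_unique by blast
qed

lemma boundary_value:
  assumes "x \<in> closure \<Omega>" "x \<notin> \<Omega>" "0 \<le> t" "t < T"
  shows "u x t = 0"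
  using assms bc[of x t] initial_boundary_value[of x] open_\<Omega>
  by (cases "t = 0") (auto simp: frontier_def interior_open)

lemma interior_radius:
  assumes "x0 \<in> \<Omega>" "0 < t0"
  obtains e where "e > 0" "ball x0 e \<subseteq> \<Omega>" "e \<le> t0"
proof -
  obtain d where "d > 0" "ball x0 d \<subseteq> \<Omega>" using open_\<Omega> assms(1) open_contains_ball by blast
  then show thesis using that[of "min d t0"] assms(2) by (auto simp: subset_eq)
qed

text \<open>At a negative minimum of \<open>u\<close> plus the tilt \<open>\<epsilon> * s\<close>
  the gradient vanishes while \<open>h\<close> and the Laplacian are nonnegative. The equation then
  gives a nonnegative time derivative, against the tilt.\<close>

lemma u_nonneg:
  assumes "x \<in> \<Omega>" "0 \<le> t" "t < T"
  shows "0 \<le> u x t"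
proof (rule ccontr)
  assume neg: "\<not> 0 \<le> u x t"
  define \<epsilon> where "\<epsilon> = - u x t / (2 * T)"
  have \<epsilon>: "\<epsilon> > 0" using neg T by (simp add: \<epsilon>_def divide_neg_pos)
  have "\<epsilon> * t \<le> \<epsilon> * T" using \<epsilon> assms by simp
  also have "\<dots> < - u x t" using neg T by (simp add: \<epsilon>_def)
  finally have pos: "- u x t - \<epsilon> * t > 0" by simp
  define w where "w = (\<lambda>(y, s). - u y s - \<epsilon> * s)"
  have "continuous_on (closure \<Omega> \<times> {0..t}) (\<lambda>(x, t). u x t)"
    by (rule continuous_on_subset[OF cont_u]) (use assms in auto)
  then have "continuous_on (closure \<Omega> \<times> {0..t}) w"
    unfolding w_def by (auto simp: split_beta' intro!: continuous_intros)
  moreover have "(x, t) \<in> closure \<Omega> \<times> {0..t}" using assms closure_subset[of \<Omega>] by auto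
  ultimately obtain z0 where z0: "z0 \<in> closure \<Omega> \<times> {0..t}"
    and max: "\<And>z. z \<in> closure \<Omega> \<times> {0..t} \<Longrightarrow> w z \<le> w z0"
    using continuous_attains_sup[OF compact_cylinder[of t], of w] by blast
  obtain x0 t0 where zt: "z0 = (x0, t0)" by (cases z0)
  have t0: "0 \<le> t0" "t0 \<le> t" "t0 < T" and x0: "x0 \<in> closure \<Omega>" using z0 zt assms by auto
  have w0: "- u x0 t0 - \<epsilon> * t0 > 0"
    using max[of "(x, t)"] pos \<open>(x, t) \<in> _\<close> by (simp add: w_def zt)
  have "x0 \<in> \<Omega>"
  proof (rule ccontr)
    assume "x0 \<notin> \<Omega>"
    then have "u x0 t0 = 0" using boundary_value x0 t0 by auto
    then show False using w0 \<epsilon> t0 by (simp add: zero_less_mult_iff mult_less_0_iff)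
  qed
  moreover have "t0 > 0" using w0 u0_nonneg[OF \<open>x0 \<in> \<Omega>\<close>] t0 by (cases "t0 = 0") auto
  ultimately obtain e where e: "e > 0" "ball x0 e \<subseteq> \<Omega>" "e \<le> t0" using interior_radius by blast
  have t: "((\<lambda>s. - u x0 s - \<epsilon> * s) has_real_derivative - D x0 t0 - \<epsilon>) (at t0)"
    using u_time[OF \<open>x0 \<in> \<Omega>\<close> \<open>t0 > 0\<close> t0(3)] by (auto intro!: derivative_eq_intros)
  have G: "((\<lambda>y. - u y t0 - \<epsilon> * t0) has_derivative (\<lambda>v. v \<bullet> - g y t0)) (at y)" if "y \<in> ball x0 e" for y
    using u_grad[of y t0] that e t0 by (auto intro!: derivative_eq_intros)
  have Hs: "((\<lambda>y. - g y t0) has_derivative (\<lambda>v. - H x0 t0 v)) (at x0)"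
    using g_hess[OF \<open>x0 \<in> \<Omega>\<close> \<open>t0 > 0\<close> t0(3)] by (rule has_derivative_minus)
  have M: "- u y s - \<epsilon> * s \<le> - u x0 t0 - \<epsilon> * t0" if "y \<in> ball x0 e" "t0 - e < s" "s \<le> t0" for y s
  proof -
    have "y \<in> closure \<Omega>" using that e closure_subset[of \<Omega>] by auto
    then show ?thesis using max[of "(y, s)"] that e t0 by (auto simp: w_def zt)
  qed
  note test = parabolic_max_test[of e x0 "\<lambda>y s. - u y s - \<epsilon> * s", OF e(1) G Hs t M]
  have "g x0 t0 = 0" "0 \<le> (\<Sum>b\<in>Basis. H x0 t0 b \<bullet> b)" "D x0 t0 \<le> - \<epsilon>"
    using test by (auto simp: sum_negf)
  then show False
    using pde[OF \<open>x0 \<in> \<Omega>\<close> \<open>t0 > 0\<close> t0(3)] h_nonneg[OF \<open>x0 \<in> \<Omega>\<close>] \<epsilon> by simp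
qed

text \<open>At a maximum of the tilted difference of \<open>u\<close> and its rotated copy, the two
  gradients correspond under \<open>Q\<close> and have equal norms. The nonlinear terms therefore
  cancel exactly, whatever the size of the gradient, and only the differences of \<open>h\<close>
  and of the initial data remain.\<close>

lemma isometry_comparison:
  assumes Q: "orthogonal_transformation Q"
    and S\<Omega>: "\<And>x. x \<in> \<Omega> \<Longrightarrow> c + Q (x - c) \<in> \<Omega>"
    and SF: "\<And>x. x \<in> frontier \<Omega> \<Longrightarrow> c + Q (x - c) \<in> frontier \<Omega>"
    and A: "\<And>x. x \<in> \<Omega> \<Longrightarrow> u (c + Q (x - c)) 0 - u x 0 \<le> A" "A \<ge> 0"
    and B: "\<And>x. x \<in> \<Omega> \<Longrightarrow> h (c + Q (x - c)) - h x \<le> B" "B \<ge> 0"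
    and "x \<in> \<Omega>" "0 \<le> t" "t < T"
  shows "u (c + Q (x - c)) t - u x t \<le> A + B * t"
proof (rule ccontr)
  define S where "S x = c + Q (x - c)" for x
  have lQ: "linear Q" using Q by (rule orthogonal_transformation_linear)
  have contS: "continuous_on X S" for X
    unfolding S_def using lQ by (intro continuous_intros linear_continuous_on_compose[of _ _ Q])
      (auto intro!: continuous_intros)
  have Scl: "S x \<in> closure \<Omega>" if "x \<in> closure \<Omega>" for x
    using S\<Omega>[of x] SF[of x] that closure_subset[of \<Omega>] open_\<Omega>
    by (auto simp: S_def frontier_def interior_open)
  have SF': "S x \<in> closure \<Omega> - \<Omega>" if "x \<in> closure \<Omega> - \<Omega>" for x
    using SF[of x] that open_\<Omega> by (auto simp: S_def frontier_def interior_open)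
  assume "\<not> ?thesis"
  then have neg: "u (S x) t - u x t - A - B * t > 0" by (simp add: S_def)
  define \<epsilon> where "\<epsilon> = (u (S x) t - u x t - A - B * t) / (2 * T)"
  have \<epsilon>: "\<epsilon> > 0" using neg T by (simp add: \<epsilon>_def)
  have "\<epsilon> * t \<le> \<epsilon> * T" using \<epsilon> assms by simp
  also have "\<dots> < u (S x) t - u x t - A - B * t" using neg T by (simp add: \<epsilon>_def)
  finally have pos: "u (S x) t - u x t - (B + \<epsilon>) * t > A" by (simp add: algebra_simps)
  define w where "w = (\<lambda>(y, s). u (S y) s - u y s - (B + \<epsilon>) * s)"
  have c1: "continuous_on (closure \<Omega> \<times> {0..t}) (\<lambda>(x, t). u x t)"
    by (rule continuous_on_subset[OF cont_u]) (use assms in auto)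
  have c2: "continuous_on (closure \<Omega> \<times> {0..t}) (\<lambda>z. (\<lambda>(x, t). u x t) (S (fst z), snd z))"
    by (rule continuous_on_compose2[OF c1])
      (auto intro!: continuous_intros Scl continuous_on_compose2[OF contS[of UNIV]])
  have "continuous_on (closure \<Omega> \<times> {0..t}) w"
    unfolding w_def using c1 c2 by (auto simp: split_beta' intro!: continuous_intros)
  moreover have "(x, t) \<in> closure \<Omega> \<times> {0..t}" using assms closure_subset[of \<Omega>] by auto
  ultimately obtain z0 where z0: "z0 \<in> closure \<Omega> \<times> {0..t}"
    and max: "\<And>z. z \<in> closure \<Omega> \<times> {0..t} \<Longrightarrow> w z \<le> w z0"
    using continuous_attains_sup[OF compact_cylinder[of t], of w] by blast
  obtain x0 t0 where zt: "z0 = (x0, t0)" by (cases z0)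
  have t0: "0 \<le> t0" "t0 \<le> t" "t0 < T" and x0: "x0 \<in> closure \<Omega>" using z0 zt assms by auto
  have w0: "u (S x0) t0 - u x0 t0 - (B + \<epsilon>) * t0 > A"
    using max[of "(x, t)"] pos \<open>(x, t) \<in> _\<close> by (simp add: w_def zt)
  have x0\<Omega>: "x0 \<in> \<Omega>"
  proof (rule ccontr)
    assume "x0 \<notin> \<Omega>"
    then have "u x0 t0 = 0" "u (S x0) t0 = 0" using boundary_value x0 t0 SF'[of x0] by auto
    moreover have "(B + \<epsilon>) * t0 \<ge> 0" using \<epsilon> B(2) t0 by simp
    ultimately show False using w0 A(2) by simp
  qed
  moreover have "t0 > 0" using w0 A(1)[OF x0\<Omega>] t0 by (cases "t0 = 0") (auto simp: S_def)
  ultimately obtain e where e: "e > 0" "ball x0 e \<subseteq> \<Omega>" "e \<le> t0" using interior_radius by blast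
  have S\<Omega>': "S y \<in> \<Omega>" if "y \<in> \<Omega>" for y using S\<Omega>[OF that] by (simp add: S_def)
  have dS: "(S has_derivative Q) (at y)" for y
  proof -
    have "((\<lambda>x. x - c) has_derivative (\<lambda>v. v)) (at y)" by (auto intro!: derivative_eq_intros)
    from has_derivative_compose[OF this linear_imp_has_derivative[OF lQ]]
    have "((\<lambda>x. c + Q (x - c)) has_derivative (\<lambda>v. 0 + Q v)) (at y)"
      by (intro has_derivative_add has_derivative_const)
    then show ?thesis by (simp add: S_def[abs_def])
  qed
  have t: "((\<lambda>s. u (S x0) s - u x0 s - (B + \<epsilon>) * s) has_real_derivative
      D (S x0) t0 - D x0 t0 - (B + \<epsilon>)) (at t0)"
    using u_time[OF x0\<Omega> \<open>t0 > 0\<close> t0(3)] u_time[OF S\<Omega>'[OF x0\<Omega>] \<open>t0 > 0\<close> t0(3)]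
    by (auto intro!: derivative_eq_intros)
  have G: "((\<lambda>y. u (S y) t0 - u y t0 - (B + \<epsilon>) * t0) has_derivative
      (\<lambda>v. v \<bullet> (adjoint Q (g (S y) t0) - g y t0))) (at y)" if "y \<in> ball x0 e" for y
  proof -
    have y: "y \<in> \<Omega>" using that e by auto
    show ?thesis
      using has_derivative_compose[OF dS u_grad[OF S\<Omega>'[OF y] t0(1,3)]] u_grad[OF y t0(1,3)]
      by (auto intro!: derivative_eq_intros simp: inner_diff_right adjoint_works[OF lQ])
  qed
  have Hs: "((\<lambda>y. adjoint Q (g (S y) t0) - g y t0) has_derivative
      (\<lambda>v. adjoint Q (H (S x0) t0 (Q v)) - H x0 t0 v)) (at x0)"
    using has_derivative_compose[OF has_derivative_compose[OF dS g_hess[OF S\<Omega>'[OF x0\<Omega>] \<open>t0 > 0\<close> t0(3)]]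
        linear_imp_has_derivative[OF adjoint_linear[OF lQ]]]
      g_hess[OF x0\<Omega> \<open>t0 > 0\<close> t0(3)] by (rule has_derivative_diff)
  have M: "u (S y) s - u y s - (B + \<epsilon>) * s \<le> u (S x0) t0 - u x0 t0 - (B + \<epsilon>) * t0"
    if "y \<in> ball x0 e" "t0 - e < s" "s \<le> t0" for y s
  proof -
    have "y \<in> closure \<Omega>" using that e closure_subset[of \<Omega>] by auto
    then show ?thesis using max[of "(y, s)"] that e t0 by (auto simp: w_def zt)
  qed
  note test = parabolic_max_test[of e x0 "\<lambda>y s. u (S y) s - u y s - (B + \<epsilon>) * s", OF e(1) G Hs t M]
  have "adjoint Q (g (S x0) t0) = g x0 t0" using test(1) by simp
  moreover have "norm (adjoint Q z) = norm z" for z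
    by (simp add: norm_eq_sqrt_inner inner_adjoint_orthogonal[OF Q])
  ultimately have n: "norm (g (S x0) t0) = norm (g x0 t0)" by metis
  have "(\<Sum>b\<in>Basis. (adjoint Q (H (S x0) t0 (Q b)) - H x0 t0 b) \<bullet> b) \<le> 0"
    using test(2) by simp
  also have "(\<Sum>b\<in>Basis. (adjoint Q (H (S x0) t0 (Q b)) - H x0 t0 b) \<bullet> b)
    = (\<Sum>b\<in>Basis. H (S x0) t0 (Q b) \<bullet> Q b) - (\<Sum>b\<in>Basis. H x0 t0 b \<bullet> b)"
    by (simp add: inner_diff_left sum_subtractf inner_commute[of "adjoint Q _"] adjoint_works[OF lQ]
        inner_commute[of "Q _"])
  also have "(\<Sum>b\<in>Basis. H (S x0) t0 (Q b) \<bullet> Q b) = (\<Sum>b\<in>Basis. H (S x0) t0 b \<bullet> b)"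
    using g_hess[OF S\<Omega>'[OF x0\<Omega>] \<open>t0 > 0\<close> t0(3)]
    by (intro trace_orthogonal_conjugation[OF Q]) (rule has_derivative_linear)
  finally show False
    using test(3) pde[OF x0\<Omega> \<open>t0 > 0\<close> t0(3)] pde[OF S\<Omega>'[OF x0\<Omega>] \<open>t0 > 0\<close> t0(3)] n
      B(1)[OF x0\<Omega>] \<epsilon> by (simp add: S_def)
qed

end

subsection \<open>Touching a directional derivative from above\<close>

lemma dist_Pair_le: "dist (a, b) (c, d) \<le> dist a c + dist b d"
  unfolding dist_Pair_Pair by (rule sqrt_sum_squares_le_sum) auto

context viscous_hj begin

text \<open>Subtracting the affine function with slope \<open>g x t\<close> leaves a function whose
  derivative along the segment is at most \<omega>. The sign \<sigma> gives the two halves of the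
  absolute value.\<close>

lemma difference_quotient_close:
  assumes x: "\<And>s. 0 \<le> s \<Longrightarrow> s \<le> \<rho> \<Longrightarrow> x + s *\<^sub>R e \<in> \<Omega>" and t: "0 \<le> t" "t < T"
    and "0 < \<rho>" "norm e = 1"
    and close: "\<And>s. 0 \<le> s \<Longrightarrow> s \<le> \<rho> \<Longrightarrow> norm (g (x + s *\<^sub>R e) t - g x t) \<le> \<omega>"
  shows "\<bar>(u (x + \<rho> *\<^sub>R e) t - u x t) / \<rho> - e \<bullet> g x t\<bar> \<le> \<omega>"
proof -
  have *: "\<sigma> * (u (x + \<rho> *\<^sub>R e) t - (x + \<rho> *\<^sub>R e) \<bullet> g x t) - \<sigma> * (u x t - x \<bullet> g x t) \<le> \<omega> * \<rho>"
    if "\<bar>\<sigma>\<bar> = 1" for \<sigma>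
  proof -
    have "(\<lambda>y. \<sigma> * (u y t - y \<bullet> g x t)) (x + \<rho> *\<^sub>R e)
        - (\<lambda>y. \<sigma> * (u y t - y \<bullet> g x t)) (x + 0 *\<^sub>R e) \<le> \<omega> * \<rho>"
    proof (rule bounded_gradient_difference_le[where \<gamma>' = "\<lambda>_. e" and G = "\<lambda>y. \<sigma> *\<^sub>R (g y t - g x t)"])
      fix s assume s: "0 \<le> s" "s \<le> \<rho>"
      show "((\<lambda>s. x + s *\<^sub>R e) has_vector_derivative e) (at s)"
        by (auto intro!: derivative_eq_intros simp: has_vector_derivative_def)
      show "((\<lambda>y. \<sigma> * (u y t - y \<bullet> g x t)) has_derivative
          (\<lambda>v. v \<bullet> \<sigma> *\<^sub>R (g (x + s *\<^sub>R e) t - g x t))) (at (x + s *\<^sub>R e))"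
        using u_grad[OF x[OF s] t] by (auto intro!: derivative_eq_intros simp: algebra_simps)
      have "e \<bullet> \<sigma> *\<^sub>R (g (x + s *\<^sub>R e) t - g x t) \<le> norm e * norm (\<sigma> *\<^sub>R (g (x + s *\<^sub>R e) t - g x t))"
        by (rule norm_cauchy_schwarz)
      also have "\<dots> \<le> \<omega>" using close[OF s] that \<open>norm e = 1\<close> by simp
      finally show "e \<bullet> \<sigma> *\<^sub>R (g (x + s *\<^sub>R e) t - g x t) \<le> \<omega>" .
    qed (use \<open>0 < \<rho>\<close> in simp)
    then show ?thesis by simp
  qed
  have "\<bar>(u (x + \<rho> *\<^sub>R e) t - u x t) - \<rho> * (e \<bullet> g x t)\<bar> \<le> \<omega> * \<rho>"
    using *[of 1] *[of "-1"] by (simp add: algebra_simps abs_le_iff)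
  then show ?thesis using \<open>0 < \<rho>\<close>
    by (simp add: abs_le_iff field_simps)
qed

lemma h_increment_le:
  assumes x: "\<And>s. 0 \<le> s \<Longrightarrow> s \<le> \<rho> \<Longrightarrow> x + s *\<^sub>R e \<in> \<Omega>" and "0 \<le> \<rho>" "norm e = 1"
  shows "h (x + \<rho> *\<^sub>R e) - h x \<le> Lh * \<rho>"
proof -
  have "h (x + \<rho> *\<^sub>R e) - h (x + 0 *\<^sub>R e) \<le> Lh * \<rho>"
  proof (rule bounded_gradient_difference_le[where \<gamma>' = "\<lambda>_. e" and G = gh])
    fix s assume s: "0 \<le> s" "s \<le> \<rho>"
    show "((\<lambda>s. x + s *\<^sub>R e) has_vector_derivative e) (at s)"
      by (auto intro!: derivative_eq_intros simp: has_vector_derivative_def)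
    show "(h has_derivative (\<lambda>v. v \<bullet> gh (x + s *\<^sub>R e))) (at (x + s *\<^sub>R e))"
      by (rule h_grad[OF x[OF s]])
    show "e \<bullet> gh (x + s *\<^sub>R e) \<le> Lh"
      using norm_cauchy_schwarz[of e "gh (x + s *\<^sub>R e)"] gh_bound[OF x[OF s]] \<open>norm e = 1\<close> by simp
  qed (use assms in simp)
  then show ?thesis by simp
qed

text \<open>Formally \<open>w = e \<bullet> \<nabla>u\<close> solves \<open>w\<^sub>t - \<Delta>w = p \<bar>\<nabla>u\<bar>\<^sup>p\<^sup>-\<^sup>2 \<nabla>u \<bullet> \<nabla>w + e \<bullet> \<nabla>h\<close>, but third derivatives of \<open>u\<close> need not
  exist. The inequality holds in the viscosity sense: difference quotients of \<open>u\<close> converge uniformly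
  to \<open>w\<close>, so after a strict perturbation of \<open>Z\<close> they attain a maximum near the touching point.\<close>

lemma directional_derivative_touching:
  assumes x0: "x0 \<in> \<Omega>" and t0: "0 < t0" "t0 < T" and e: "norm e = 1" and "\<delta> > 0"
    and Z: "\<And>x. x \<in> ball x0 \<delta> \<Longrightarrow> (Z has_derivative (\<lambda>v. v \<bullet> gZ x)) (at x)"
    and gZ: "\<And>x. x \<in> ball x0 \<delta> \<Longrightarrow> (gZ has_derivative HZ x) (at x)"
    and lap: "isCont (\<lambda>x. \<Sum>b\<in>Basis. HZ x b \<bullet> b) x0"
    and max: "\<And>x t. x \<in> ball x0 \<delta> \<Longrightarrow> x \<in> \<Omega> \<Longrightarrow> t0 - \<delta> < t \<Longrightarrow> 0 < t \<Longrightarrow> t \<le> t0 \<Longrightarrow>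
      e \<bullet> g x t - Z x \<le> e \<bullet> g x0 t0 - Z x0"
  shows "0 \<le> (\<Sum>b\<in>Basis. HZ x0 b \<bullet> b) + p * norm (g x0 t0) powr (p - 2) * (g x0 t0 \<bullet> gZ x0) + Lh"
proof (rule ccontr)
  assume neg: "\<not> ?thesis"
  define N where "N = real DIM('a)"
  \<comment> \<open>The touching inequality for the barrier perturbed by \<kappa> times the squared
    distance and by \<kappa> times the elapsed time, as a function of point, gradient and \<kappa>.
    At \<open>?z0\<close> it is the negated claim, and continuity keeps it negative nearby.\<close>
  define \<Theta> where "\<Theta> z = (\<Sum>b\<in>Basis. HZ (fst z) b \<bullet> b) + 2 * snd (snd z) * N
    + p * norm (fst (snd z)) powr (p - 2) * (fst (snd z) \<bullet> (gZ (fst z) + (2 * snd (snd z)) *\<^sub>R (fst z - x0)))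
    + Lh + snd (snd z)" for z :: "'a \<times> 'a \<times> real"
  let ?z0 = "(x0, g x0 t0, 0::real)"
  have "(gZ has_derivative HZ x0) (at x0)" using gZ \<open>\<delta> > 0\<close> by simp
  then have "isCont gZ x0" by (rule has_derivative_continuous)
  have tf: "(fst \<longlongrightarrow> x0) (nhds ?z0)" and ts: "((\<lambda>z. fst (snd z)) \<longlongrightarrow> g x0 t0) (nhds ?z0)"
    and tk: "((\<lambda>z. snd (snd z)) \<longlongrightarrow> 0) (nhds ?z0)"
    using tendsto_fst[OF filterlim_ident[of "nhds ?z0"]] tendsto_fst[OF tendsto_snd[OF filterlim_ident[of "nhds ?z0"]]]
      tendsto_snd[OF tendsto_snd[OF filterlim_ident[of "nhds ?z0"]]] by (simp_all add: id_def)
  \<comment> \<open>Since \<open>p - 2\<close> is positive, the power is continuous even where the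
    gradient vanishes.\<close>
  have "(\<Theta> \<longlongrightarrow> (\<Sum>b\<in>Basis. HZ x0 b \<bullet> b) + 2 * 0 * N
    + p * norm (g x0 t0) powr (p - 2) * (g x0 t0 \<bullet> (gZ x0 + (2 * 0) *\<^sub>R (x0 - x0))) + Lh + 0) (nhds ?z0)"
    unfolding \<Theta>_def
    by (intro tendsto_intros isCont_tendsto_compose[OF lap] isCont_tendsto_compose[OF \<open>isCont gZ x0\<close>]
        tendsto_powr' tf ts tk) (use p in auto)
  then have "eventually (\<lambda>z. \<Theta> z < 0) (nhds ?z0)"
    by (rule order_tendstoD(2)) (use neg in simp)
  then obtain r where r: "r > 0" "\<And>z. dist z ?z0 < r \<Longrightarrow> \<Theta> z < 0"
    by (auto simp: eventually_nhds_metric)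
  define \<kappa> where "\<kappa> = r / 4"
  have \<kappa>: "\<kappa> > 0" using r by (simp add: \<kappa>_def)
  have \<Theta>neg: "\<Theta> (x, \<xi>, \<kappa>) < 0" if "dist x x0 < r / 4" "dist \<xi> (g x0 t0) < r / 4" for x \<xi>
  proof (rule r(2))
    have "dist (x, \<xi>, \<kappa>) ?z0 \<le> dist x x0 + (dist \<xi> (g x0 t0) + dist \<kappa> 0)"
      by (rule order_trans[OF dist_Pair_le add_left_mono[OF dist_Pair_le]])
    also have "\<dots> < r" using that \<kappa> by (simp add: \<kappa>_def)
    finally show "dist (x, \<xi>, \<kappa>) ?z0 < r" .
  qed
  have uc: "uniformly_continuous_on (\<Omega> \<times> {0..t0}) (\<lambda>(x, t). g x t)"
    by (rule gradient_uniformly_continuous[OF t0(2)])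
  have gclose: "\<exists>\<eta>>0. \<forall>x y. \<forall>s t. x \<in> \<Omega> \<longrightarrow> y \<in> \<Omega> \<longrightarrow> 0 \<le> s \<longrightarrow> s \<le> t0 \<longrightarrow> 0 \<le> t \<longrightarrow> t \<le> t0 \<longrightarrow>
      dist x y + dist s t < \<eta> \<longrightarrow> dist (g x s) (g y t) < \<epsilon>" if \<epsilon>: "\<epsilon> > 0" for \<epsilon>
  proof -
    obtain \<eta> where \<eta>: "\<eta> > 0" "\<And>z z'. z \<in> \<Omega> \<times> {0..t0} \<Longrightarrow> z' \<in> \<Omega> \<times> {0..t0} \<Longrightarrow> dist z' z < \<eta> \<Longrightarrow>
        dist ((\<lambda>(x, t). g x t) z') ((\<lambda>(x, t). g x t) z) < \<epsilon>"
      using uc \<epsilon> unfolding uniformly_continuous_on_def by metis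
    show ?thesis
    proof (intro exI[of _ \<eta>] conjI allI impI \<open>\<eta> > 0\<close>)
      fix x y s t assume *: "x \<in> \<Omega>" "y \<in> \<Omega>" "0 \<le> s" "s \<le> t0" "0 \<le> t" "t \<le> t0" "dist x y + dist s t < \<eta>"
      have "dist (x, s) (y, t) < \<eta>" using dist_Pair_le[of x s y t] *(7) by linarith
      then show "dist (g x s) (g y t) < \<epsilon>" using \<eta>(2)[of "(y, t)" "(x, s)"] * by simp
    qed
  qed
  obtain \<eta>0 where \<eta>0: "\<eta>0 > 0" "\<And>x y s t. x \<in> \<Omega> \<Longrightarrow> y \<in> \<Omega> \<Longrightarrow> 0 \<le> s \<Longrightarrow> s \<le> t0 \<Longrightarrow> 0 \<le> t \<Longrightarrow> t \<le> t0 \<Longrightarrow>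
      dist x y + dist s t < \<eta>0 \<Longrightarrow> dist (g x s) (g y t) < r / 4"
    using gclose[of "r / 4"] r(1) by auto
  obtain d0 where d0: "d0 > 0" "ball x0 d0 \<subseteq> \<Omega>" "d0 \<le> t0" using interior_radius[OF x0 t0(1)] by blast
  define r1 where "r1 = min (min d0 \<delta>) (min r \<eta>0) / 5"
  have r1: "0 < r1" "4 * r1 < d0" "4 * r1 < \<delta>" "4 * r1 < r" "4 * r1 < \<eta>0" "4 * r1 < t0"
    using d0 \<open>\<delta> > 0\<close> r(1) \<eta>0(1) by (auto simp: r1_def)
  \<comment> \<open>Replacing the derivative by a quotient costs at most \<omega> at each of the two
    points compared. With \<open>2 * \<omega>\<close> below both penalties, the maximum stays off
    the lateral boundary and the initial time of \<open>?K\<close>.\<close>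
  define \<omega> where "\<omega> = \<kappa> * min (r1\<^sup>2) r1 / 4"
  have \<omega>: "\<omega> > 0" "2 * \<omega> < \<kappa> * r1\<^sup>2" "2 * \<omega> < \<kappa> * r1"
    using \<kappa> r1(1) unfolding \<omega>_def by (auto simp: min_def)
  obtain \<eta>1 where \<eta>1: "\<eta>1 > 0" "\<And>x y s t. x \<in> \<Omega> \<Longrightarrow> y \<in> \<Omega> \<Longrightarrow> 0 \<le> s \<Longrightarrow> s \<le> t0 \<Longrightarrow> 0 \<le> t \<Longrightarrow> t \<le> t0 \<Longrightarrow>
      dist x y + dist s t < \<eta>1 \<Longrightarrow> dist (g x s) (g y t) < \<omega>"
    using gclose[of \<omega>] \<omega>(1) by auto
  define \<rho> where "\<rho> = min r1 \<eta>1 / 2"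
  have \<rho>: "0 < \<rho>" "\<rho> \<le> r1" "\<rho> < \<eta>1" using r1(1) \<eta>1(1) by (auto simp: \<rho>_def)
  have inB: "x + s *\<^sub>R e \<in> ball x0 (2 * r1 + s')" if "x \<in> cball x0 r1" "0 \<le> s" "s \<le> \<rho>" "s' > 0" for x s s'
  proof -
    have "norm (x + s *\<^sub>R e - x0) \<le> norm (x - x0) + norm (s *\<^sub>R e)"
      by (metis add_diff_eq add.commute norm_triangle_ineq)
    then show ?thesis using that e \<rho>(2) by (simp add: dist_norm norm_minus_commute)
  qed
  have in\<Omega>: "x + s *\<^sub>R e \<in> \<Omega>" if "x \<in> cball x0 r1" "0 \<le> s" "s \<le> \<rho>" for x s
    using inB[OF that, of r1] d0(2) r1 by auto
  have in\<Omega>0: "x \<in> \<Omega>" if "x \<in> cball x0 r1" for x using in\<Omega>[OF that, of 0] \<rho> by simp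
  define q where "q x t = (u (x + \<rho> *\<^sub>R e) t - u x t) / \<rho>" for x t
  have q: "\<bar>q x t - e \<bullet> g x t\<bar> \<le> \<omega>" if "x \<in> cball x0 r1" "0 \<le> t" "t \<le> t0" for x t
    unfolding q_def
  proof (rule difference_quotient_close)
    fix s assume s: "0 \<le> s" "s \<le> \<rho>"
    show "norm (g (x + s *\<^sub>R e) t - g x t) \<le> \<omega>"
      using \<eta>1(2)[OF in\<Omega>[OF that(1) s] in\<Omega>0[OF that(1)] that(2,3) that(2,3)] s \<rho>(3) e
      by (simp add: dist_norm)
  qed (use in\<Omega>[OF that(1)] that t0 \<rho> e in auto)
  define W where "W = (\<lambda>(x, t). q x t - Z x - \<kappa> * ((x - x0) \<bullet> (x - x0)) - \<kappa> * (t0 - t))"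
  let ?K = "cball x0 r1 \<times> {t0 - r1..t0}"
  have "continuous_on ?K W"
  proof -
    have c1: "continuous_on (closure \<Omega> \<times> {0..t0}) (\<lambda>(x, t). u x t)"
      by (rule continuous_on_subset[OF cont_u]) (use t0 in auto)
    have "continuous_on ?K (\<lambda>z. (\<lambda>(x, t). u x t) (fst z + \<rho> *\<^sub>R e, snd z))"
      using in\<Omega>[of _ \<rho>] \<rho> closure_subset[of \<Omega>] r1
      by (intro continuous_on_compose2[OF c1]) (auto intro!: continuous_intros)
    moreover have "continuous_on ?K (\<lambda>z. (\<lambda>(x, t). u x t) (fst z, snd z))"
      using in\<Omega>0 closure_subset[of \<Omega>] r1
      by (intro continuous_on_compose2[OF c1]) (auto intro!: continuous_intros)
    moreover have "continuous_on ?K (\<lambda>z. Z (fst z))"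
    proof (rule continuous_on_compose2[of "cball x0 r1" Z])
      show "continuous_on (cball x0 r1) Z"
        using r1 by (intro continuous_at_imp_continuous_on ballI has_derivative_continuous[OF Z]) auto
    qed (auto intro!: continuous_intros)
    ultimately show ?thesis unfolding W_def q_def
      using \<rho> by (auto simp: split_beta' intro!: continuous_intros)
  qed
  moreover have "compact ?K" by (intro compact_Times) auto
  moreover have z0K: "(x0, t0) \<in> ?K" using r1 by auto
  ultimately obtain z1 where z1: "z1 \<in> ?K" and Wmax: "\<And>z. z \<in> ?K \<Longrightarrow> W z \<le> W z1"
    using continuous_attains_sup[of ?K W] by blast
  obtain x1 t1 where zt: "z1 = (x1, t1)" by (cases z1)
  have x1: "x1 \<in> cball x0 r1" and t1: "t0 - r1 \<le> t1" "t1 \<le> t0" "0 < t1" "t1 < T"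
    using z1 zt r1 t0 by auto
  have x1b: "x1 \<in> ball x0 \<delta>" using x1 r1 by auto
  have "e \<bullet> g x0 t0 - Z x0 - \<omega> \<le> W (x0, t0)"
    using q[of x0 t0] r1 t0 by (auto simp: W_def abs_le_iff)
  also have "\<dots> \<le> W (x1, t1)" using Wmax[OF z0K] zt by simp
  also have "\<dots> \<le> e \<bullet> g x0 t0 - Z x0 + \<omega> - \<kappa> * ((x1 - x0) \<bullet> (x1 - x0)) - \<kappa> * (t0 - t1)"
    using q[OF x1, of t1] max[OF x1b in\<Omega>0[OF x1], of t1] t1 r1 by (auto simp: W_def abs_le_iff)
  finally have small: "\<kappa> * (norm (x1 - x0))\<^sup>2 + \<kappa> * (t0 - t1) \<le> 2 * \<omega>"
    by (simp add: power2_norm_eq_inner)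
  have "\<kappa> * (norm (x1 - x0))\<^sup>2 < \<kappa> * r1\<^sup>2"
    using small \<omega>(2) \<kappa> t1 mult_nonneg_nonneg[of \<kappa> "t0 - t1"] by linarith
  then have x1s: "norm (x1 - x0) < r1" using \<kappa> r1(1) by (simp add: power_less_imp_less_base)
  have "\<kappa> * (t0 - t1) < \<kappa> * r1"
    using small \<omega>(3) \<kappa> mult_nonneg_nonneg[of \<kappa> "(norm (x1 - x0))\<^sup>2"] zero_le_power2[of "norm (x1 - x0)"]
    by linarith
  then have t1s: "t0 - r1 < t1" using \<kappa> by simp
  define e' where "e' = min (r1 - norm (x1 - x0)) (t1 - (t0 - r1))"
  have e': "e' > 0" using x1s t1s by (simp add: e'_def)
  have ballsub: "y \<in> cball x0 r1" if "y \<in> ball x1 e'" for y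
  proof -
    have "dist x0 y \<le> dist x0 x1 + dist x1 y" by (rule dist_triangle)
    then show ?thesis using that by (simp add: e'_def dist_norm norm_minus_commute)
  qed
  define Y where "Y = gZ x1 + (2 * \<kappa>) *\<^sub>R (x1 - x0)"
  define x2 where "x2 = x1 + \<rho> *\<^sub>R e"
  have x2: "x2 \<in> \<Omega>" unfolding x2_def using in\<Omega>[OF x1] \<rho> by simp
  note x1\<Omega> = in\<Omega>0[OF x1]
  let ?f = "\<lambda>y s. (u (y + \<rho> *\<^sub>R e) s - u y s) / \<rho> - Z y - \<kappa> * ((y - x0) \<bullet> (y - x0)) - \<kappa> * (t0 - s)"
  let ?G = "\<lambda>y. (1 / \<rho>) *\<^sub>R (g (y + \<rho> *\<^sub>R e) t1 - g y t1) - gZ y - (2 * \<kappa>) *\<^sub>R (y - x0)"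
  have shift: "((\<lambda>y. y + \<rho> *\<^sub>R e) has_derivative (\<lambda>v. v)) (at y)" for y :: 'a
    by (auto intro!: derivative_eq_intros)
  have G: "((\<lambda>y. ?f y t1) has_derivative (\<lambda>v. v \<bullet> ?G y)) (at y)" if "y \<in> ball x1 e'" for y
  proof -
    have y: "y \<in> cball x0 r1" using ballsub that .
    then have "y \<in> ball x0 \<delta>" using r1 by auto
    note Zy = Z[OF this]
    have u1: "((\<lambda>y. u y t1) has_derivative (\<lambda>v. v \<bullet> g y t1)) (at y)"
      using u_grad[OF in\<Omega>0[OF y]] t1 by simp
    have u2: "((\<lambda>y. u (y + \<rho> *\<^sub>R e) t1) has_derivative (\<lambda>v. v \<bullet> g (y + \<rho> *\<^sub>R e) t1)) (at y)"
      using has_derivative_compose[OF shift u_grad[OF in\<Omega>[OF y, of \<rho>], of t1]] t1 \<rho> by simp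
    have q': "((\<lambda>y. (u (y + \<rho> *\<^sub>R e) t1 - u y t1) / \<rho>) has_derivative
        (\<lambda>v. (v \<bullet> g (y + \<rho> *\<^sub>R e) t1 - v \<bullet> g y t1) / \<rho>)) (at y)"
      using has_derivative_mult_right[OF has_derivative_diff[OF u2 u1], of "1 / \<rho>"] by simp
    have sq: "((\<lambda>y. \<kappa> * ((y - x0) \<bullet> (y - x0))) has_derivative (\<lambda>v. \<kappa> * (2 * (v \<bullet> (y - x0))))) (at y)"
      by (auto intro!: derivative_eq_intros simp: inner_commute algebra_simps)
    have "((\<lambda>y. ?f y t1) has_derivative (\<lambda>v. (v \<bullet> g (y + \<rho> *\<^sub>R e) t1 - v \<bullet> g y t1) / \<rho> - v \<bullet> gZ y
        - \<kappa> * (2 * (v \<bullet> (y - x0))) - 0)) (at y)"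
      by (intro has_derivative_diff q' Zy sq has_derivative_const)
    then show ?thesis
      by (rule has_derivative_eq_rhs) (simp add: fun_eq_iff inner_diff_right right_diff_distrib diff_divide_distrib)
  qed
  have Hs: "(?G has_derivative (\<lambda>v. (1 / \<rho>) *\<^sub>R (H x2 t1 v - H x1 t1 v) - HZ x1 v - (2 * \<kappa>) *\<^sub>R v)) (at x1)"
  proof -
    have g2: "((\<lambda>y. g (y + \<rho> *\<^sub>R e) t1) has_derivative (\<lambda>v. H x2 t1 v)) (at x1)"
      using has_derivative_compose[OF shift g_hess[OF x2[unfolded x2_def] t1(3,4)]] by (simp add: x2_def)
    have "((\<lambda>y. y - x0) has_derivative (\<lambda>v. v)) (at x1)" by (auto intro!: derivative_eq_intros)
    then show ?thesis
      by (intro has_derivative_diff has_derivative_scaleR_right g2 g_hess[OF x1\<Omega> t1(3,4)] gZ[OF x1b])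
  qed
  have tm: "(?f x1 has_real_derivative (D x2 t1 - D x1 t1) / \<rho> + \<kappa>) (at t1)"
    using u_time[OF x1\<Omega> t1(3,4)] u_time[OF x2 t1(3,4)] \<rho>
    by (auto intro!: derivative_eq_intros simp: x2_def)
  have M: "?f y s \<le> ?f x1 t1" if "y \<in> ball x1 e'" "t1 - e' < s" "s \<le> t1" for y s
  proof -
    have "(y, s) \<in> ?K" using ballsub[OF that(1)] that(2,3) t1 by (auto simp: e'_def)
    from Wmax[OF this] show ?thesis by (simp add: W_def q_def zt)
  qed
  note test = parabolic_max_test[of e' x1 ?f, OF e' G Hs tm M]
  \<comment> \<open>Criticality identifies the increment of the gradient exactly. Inserted into the
    convexity inequality at the shifted point, it turns the increment of the nonlinearity into the
    drift term without third derivatives.\<close>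
  have g2: "g x2 t1 - g x1 t1 = \<rho> *\<^sub>R Y"
  proof -
    have "(1 / \<rho>) *\<^sub>R (g x2 t1 - g x1 t1) = Y" using test(1) by (simp add: x2_def Y_def algebra_simps)
    then have "\<rho> *\<^sub>R ((1 / \<rho>) *\<^sub>R (g x2 t1 - g x1 t1)) = \<rho> *\<^sub>R Y" by simp
    then show ?thesis using \<rho> by simp
  qed
  have tr: "((\<Sum>b\<in>Basis. H x2 t1 b \<bullet> b) - (\<Sum>b\<in>Basis. H x1 t1 b \<bullet> b)) / \<rho>
      \<le> (\<Sum>b\<in>Basis. HZ x1 b \<bullet> b) + 2 * \<kappa> * N"
  proof -
    have "(\<Sum>b\<in>Basis. ((1 / \<rho>) *\<^sub>R (H x2 t1 b - H x1 t1 b) - HZ x1 b - (2 * \<kappa>) *\<^sub>R b) \<bullet> b) \<le> 0"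
      using test(2) by simp
    also have "(\<Sum>b\<in>Basis. ((1 / \<rho>) *\<^sub>R (H x2 t1 b - H x1 t1 b) - HZ x1 b - (2 * \<kappa>) *\<^sub>R b) \<bullet> b)
      = ((\<Sum>b\<in>Basis. H x2 t1 b \<bullet> b) - (\<Sum>b\<in>Basis. H x1 t1 b \<bullet> b)) / \<rho>
        - (\<Sum>b\<in>Basis. HZ x1 b \<bullet> b) - 2 * \<kappa> * N"
      by (simp add: inner_diff_left sum_subtractf sum_divide_distrib diff_divide_distrib N_def)
    finally show ?thesis by simp
  qed
  define \<xi> where "\<xi> = g x2 t1"
  have "(norm \<xi> powr p - norm (g x1 t1) powr p) / \<rho> \<le> p * norm \<xi> powr (p - 2) * (\<xi> \<bullet> (\<rho> *\<^sub>R Y)) / \<rho>"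
    using norm_powr_tangent_le[of p \<xi> "g x1 t1"] p \<rho> g2 unfolding \<xi>_def by (intro divide_right_mono) auto
  then have pw: "(norm \<xi> powr p - norm (g x1 t1) powr p) / \<rho> \<le> p * norm \<xi> powr (p - 2) * (\<xi> \<bullet> Y)"
    using \<rho> by simp
  have "(h x2 - h x1) / \<rho> \<le> Lh * \<rho> / \<rho>"
    unfolding x2_def using h_increment_le[of \<rho> x1 e] in\<Omega>[OF x1] \<rho> e by (intro divide_right_mono) auto
  then have hd: "(h x2 - h x1) / \<rho> \<le> Lh" using \<rho> by simp
  have "(D x2 t1 - D x1 t1) / \<rho> = ((\<Sum>b\<in>Basis. H x2 t1 b \<bullet> b) - (\<Sum>b\<in>Basis. H x1 t1 b \<bullet> b)) / \<rho>
     + (norm \<xi> powr p - norm (g x1 t1) powr p) / \<rho> + (h x2 - h x1) / \<rho>"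
    unfolding pde[OF x1\<Omega> t1(3,4)] pde[OF x2 t1(3,4)] \<xi>_def by (simp add: add_divide_distrib diff_divide_distrib)
  then have "0 \<le> \<Theta> (x1, \<xi>, \<kappa>)"
    using test(3) tr pw hd by (simp add: \<Theta>_def Y_def)
  moreover have "\<Theta> (x1, \<xi>, \<kappa>) < 0"
  proof (rule \<Theta>neg)
    show "dist x1 x0 < r / 4" using x1s r1 by (simp add: dist_norm)
    have "dist x2 x0 \<le> dist x2 x1 + dist x1 x0" by (rule dist_triangle)
    also have "dist x2 x1 = \<rho>" using \<rho> e by (simp add: x2_def dist_norm)
    finally have "dist x2 x0 + dist t1 t0 < \<eta>0"
      using x1s t1 t1s \<rho>(2) r1 by (simp add: dist_norm)
    then show "dist \<xi> (g x0 t0) < r / 4"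
      unfolding \<xi>_def using \<eta>0(2)[OF x2 x0, of t1 t0] t1 t0 by simp
  qed
  ultimately show False by simp
qed

end

subsection \<open>The solution in a spherical shell\<close>

text \<open>A ball is the shell with \<open>ra = - R\<close>. Within distance \<open>\<rho>0\<close> of the centre, where the angular
  estimate is useless, the radial barriers will vanish because of the last assumption.\<close>

locale annular_hj = viscous_hj p T Lh K0 \<Omega> h u gh g H D
  for p T Lh K0 :: real and \<Omega> :: "'a::euclidean_space set"
    and h u gh g H D +
  fixes c :: 'a and ra R s0 \<rho>0 :: real
  assumes \<Omega>: "\<Omega> = {x. ra < dist c x \<and> dist c x < R}"
    and frontier: "frontier \<Omega> = {x. dist c x = ra \<or> dist c x = R}"
    and R: "0 < R" and \<rho>0: "0 < \<rho>0" and s0: "0 < s0" and ra: "0 < ra \<or> ra \<le> - s0"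
    and core: "\<And>x. x \<in> \<Omega> \<Longrightarrow> dist c x < \<rho>0 \<Longrightarrow> s0 < R - dist c x \<and> s0 < dist c x - ra"
begin

lemma in_\<Omega>: "x \<in> \<Omega> \<longleftrightarrow> ra < norm (x - c) \<and> norm (x - c) < R"
  by (simp add: \<Omega> dist_norm norm_minus_commute)

text \<open>Rotations about \<open>c\<close> leave the equation invariant up to a Lipschitz change of \<open>h\<close> and of the initial
  data, so a solution and its rotation by \<open>\<theta>\<close> differ by \<open>O(\<theta>)\<close>.\<close>

lemma angular_derivative_bound:
  assumes x: "x \<in> \<Omega>" and t: "0 \<le> t" "t < T" and v: "v \<bullet> (x - c) = 0" "norm v = 1"
  shows "norm (x - c) * (v \<bullet> g x t) \<le> 4 * R * (K0 + Lh * T)"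
proof (cases "x = c")
  case True
  then show ?thesis using R K0 Lh T by simp
next
  case False
  define w where "w = (1 / norm (x - c)) *\<^sub>R (x - c)"
  have w: "norm w = 1" "w \<bullet> v = 0" "(x - c) \<bullet> w = norm (x - c)" "(x - c) \<bullet> v = 0"
    using False v by (simp_all add: w_def inner_commute dot_square_norm power2_eq_square)
  define \<gamma> where "\<gamma> y \<theta> = c + plane_rotation w v \<theta> (y - c)" for y \<theta>
  define \<gamma>' where "\<gamma>' y \<theta> = (- sin \<theta> * ((y - c) \<bullet> w) - cos \<theta> * ((y - c) \<bullet> v)) *\<^sub>R w
    + (cos \<theta> * ((y - c) \<bullet> w) - sin \<theta> * ((y - c) \<bullet> v)) *\<^sub>R v" for y \<theta>
  have orth: "orthogonal_transformation (plane_rotation w v \<theta>)" for \<theta>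
    by (rule orthogonal_transformation_plane_rotation) (use w v in auto)
  have dist\<gamma>: "dist c (\<gamma> y \<theta>) = dist c y" for y \<theta>
  proof -
    have "norm (plane_rotation w v \<theta> (y - c)) = norm (y - c)"
      using orth by (rule orthogonal_transformation_norm)
    then show ?thesis by (simp add: \<gamma>_def dist_norm norm_minus_commute)
  qed
  have \<gamma>\<Omega>: "\<gamma> y \<theta> \<in> \<Omega>" if "y \<in> \<Omega>" for y \<theta> using that by (simp add: \<Omega> dist\<gamma>)
  have d\<gamma>: "(\<gamma> y has_vector_derivative \<gamma>' y \<theta>) (at \<theta>)" for y \<theta>
    unfolding \<gamma>_def \<gamma>'_def
    using has_vector_derivative_add[OF has_vector_derivative_const plane_rotation_has_vector_derivative] by simp
  \<comment> \<open>A crude speed bound: each of the four trigonometric terms is at most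
    \<open>R\<close>.\<close>
  have n\<gamma>': "norm (\<gamma>' y \<theta>) \<le> 4 * R" if "y \<in> \<Omega>" for y \<theta>
  proof -
    define a b where "a = (y - c) \<bullet> w" and "b = (y - c) \<bullet> v"
    have ab: "\<bar>a\<bar> \<le> R" "\<bar>b\<bar> \<le> R"
      using Cauchy_Schwarz_ineq2[of "y - c" w] Cauchy_Schwarz_ineq2[of "y - c" v] w v that
      by (auto simp: a_def b_def in_\<Omega>)
    have tr: "\<bar>cos \<theta> * z\<bar> \<le> R" "\<bar>sin \<theta> * z\<bar> \<le> R" if "\<bar>z\<bar> \<le> R" for z
      using that abs_cos_le_one[of \<theta>] abs_sin_le_one[of \<theta>] mult_mono[of "\<bar>cos \<theta>\<bar>" 1 "\<bar>z\<bar>" R]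
        mult_mono[of "\<bar>sin \<theta>\<bar>" 1 "\<bar>z\<bar>" R] R by (auto simp: abs_mult)
    have "norm (\<gamma>' y \<theta>) \<le> norm ((- sin \<theta> * a - cos \<theta> * b) *\<^sub>R w) + norm ((cos \<theta> * a - sin \<theta> * b) *\<^sub>R v)"
      unfolding \<gamma>'_def a_def b_def by (rule norm_triangle_ineq)
    also have "\<dots> = \<bar>- sin \<theta> * a - cos \<theta> * b\<bar> + \<bar>cos \<theta> * a - sin \<theta> * b\<bar>" using w v by simp
    also have "\<dots> \<le> 4 * R" using tr[OF ab(1)] tr[OF ab(2)] by linarith
    finally show ?thesis .
  qed
  have inc: "f (\<gamma> y \<theta>) - f y \<le> B * (4 * R) * \<theta>"
    if "0 \<le> \<theta>" "y \<in> \<Omega>" and f: "\<And>z. z \<in> \<Omega> \<Longrightarrow> (f has_derivative (\<lambda>v. v \<bullet> Gf z)) (at z)"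
      and B: "\<And>z. z \<in> \<Omega> \<Longrightarrow> norm (Gf z) \<le> B" "0 \<le> B" for f Gf B y \<theta>
  proof -
    have "f (\<gamma> y \<theta>) - f (\<gamma> y 0) \<le> B * (4 * R) * \<theta>"
    proof (rule bounded_gradient_difference_le[OF \<open>0 \<le> \<theta>\<close> d\<gamma> f[OF \<gamma>\<Omega>[OF that(2)]]])
      fix s
      have "\<gamma>' y s \<bullet> Gf (\<gamma> y s) \<le> norm (\<gamma>' y s) * norm (Gf (\<gamma> y s))" by (rule norm_cauchy_schwarz)
      also have "\<dots> \<le> (4 * R) * B"
        using n\<gamma>'[OF that(2)] B(1)[OF \<gamma>\<Omega>[OF that(2)]] R by (intro mult_mono) auto
      finally show "\<gamma>' y s \<bullet> Gf (\<gamma> y s) \<le> B * (4 * R)" by (simp add: mult.commute)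
    qed
    then show ?thesis by (simp add: \<gamma>_def)
  qed
  define K where "K = K0 * (4 * R) + Lh * (4 * R) * t"
  have cmp: "u (\<gamma> x \<theta>) t - u x t \<le> K * \<theta>" if \<theta>: "0 \<le> \<theta>" for \<theta>
  proof -
    have "u (c + plane_rotation w v \<theta> (x - c)) t - u x t \<le> K0 * (4 * R) * \<theta> + Lh * (4 * R) * \<theta> * t"
    proof (rule isometry_comparison[OF orth _ _ _ _ _ _ x t])
      show "c + plane_rotation w v \<theta> (y - c) \<in> \<Omega>" if "y \<in> \<Omega>" for y
        using \<gamma>\<Omega>[OF that] by (simp add: \<gamma>_def)
      show "c + plane_rotation w v \<theta> (y - c) \<in> frontier \<Omega>" if "y \<in> frontier \<Omega>" for y
        using dist\<gamma>[of y \<theta>] that unfolding frontier by (simp add: \<gamma>_def)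
      show "u (c + plane_rotation w v \<theta> (y - c)) 0 - u y 0 \<le> K0 * (4 * R) * \<theta>" if "y \<in> \<Omega>" for y
        using inc[OF \<theta> that u_grad[of _ 0] g0_bound K0] T by (simp add: \<gamma>_def)
      show "h (c + plane_rotation w v \<theta> (y - c)) - h y \<le> Lh * (4 * R) * \<theta>" if "y \<in> \<Omega>" for y
        using inc[OF \<theta> that h_grad gh_bound Lh] by (simp add: \<gamma>_def)
    qed (use \<theta> K0 Lh R in auto)
    then show ?thesis by (simp add: \<gamma>_def K_def algebra_simps)
  qed
  have \<gamma>0: "\<gamma> x 0 = x" "\<gamma>' x 0 = norm (x - c) *\<^sub>R v" by (simp_all add: \<gamma>_def \<gamma>'_def w)
  have "((\<lambda>\<theta>. u (\<gamma> x \<theta>) t) has_derivative (\<lambda>k. (k *\<^sub>R \<gamma>' x 0) \<bullet> g x t)) (at 0)"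
  proof (rule has_derivative_compose[of "\<gamma> x" _ 0 UNIV "\<lambda>y. u y t"])
    show "(\<gamma> x has_derivative (\<lambda>k. k *\<^sub>R \<gamma>' x 0)) (at 0)"
      using d\<gamma>[of x 0] by (simp add: has_vector_derivative_def)
    show "((\<lambda>y. u y t) has_derivative (\<lambda>v. v \<bullet> g x t)) (at (\<gamma> x 0))"
      using u_grad[OF x t] by (simp add: \<gamma>0)
  qed
  then have "((\<lambda>\<theta>. u (\<gamma> x \<theta>) t) has_real_derivative norm (x - c) * (v \<bullet> g x t)) (at 0)"
    by (rule has_derivative_imp_has_field_derivative) (simp add: \<gamma>0)
  then have "((\<lambda>\<theta>. u (\<gamma> x \<theta>) t - K * \<theta>) has_real_derivative norm (x - c) * (v \<bullet> g x t) - K) (at 0)"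
    by (auto intro!: derivative_eq_intros)
  \<comment> \<open>The comparison holds for every \<theta> \<ge> 0 with equality at
    \<open>0\<close>, so this derivative cannot be positive. The factor \<open>norm (x - c)\<close>
    is the speed of the orbit at \<theta> = 0.\<close>
  note der = DERIV_pos_inc_right[OF this]
  have "norm (x - c) * (v \<bullet> g x t) \<le> K"
  proof (rule ccontr)
    assume "\<not> ?thesis"
    then obtain d where d: "d > 0" "\<And>k. 0 < k \<Longrightarrow> k < d \<Longrightarrow> u (\<gamma> x 0) t - K * 0 < u (\<gamma> x k) t - K * k"
      using der by auto
    show False using d(2)[of "d / 2"] d(1) cmp[of "d / 2"] by (simp add: \<gamma>0)
  qed
  also have "K \<le> 4 * R * (K0 + Lh * T)"
  proof -
    have "(4 * R * Lh) * t \<le> (4 * R * Lh) * T" using t R Lh by (intro mult_left_mono) auto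
    then show ?thesis by (simp add: K_def algebra_simps)
  qed
  finally show ?thesis .
qed

text \<open>The angular bound divided by the smallest radius at which it is used; it depends on
  \<open>T\<close> but not on the time considered.\<close>

definition K1 where "K1 = 4 * R * (K0 + Lh * T) / \<rho>0"

lemma K1_nonneg: "0 \<le> K1"
  using R K0 Lh T \<rho>0 by (simp add: K1_def)

lemma tangential_bound:
  assumes x: "x \<in> \<Omega>" "\<rho>0 \<le> norm (x - c)" and t: "0 \<le> t" "t < T" and w: "w \<bullet> (x - c) = 0"
  shows "w \<bullet> g x t \<le> norm w * K1"
proof (cases "w = 0")
  case False
  define v where "v = (1 / norm w) *\<^sub>R w"
  have v: "norm v = 1" "v \<bullet> (x - c) = 0" "w = norm w *\<^sub>R v" using False w by (simp_all add: v_def)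
  have "v \<bullet> g x t \<le> 4 * R * (K0 + Lh * T) / norm (x - c)"
    using angular_derivative_bound[OF x(1) t v(2,1)] x(2) \<rho>0
    by (subst pos_le_divide_eq) (auto simp: mult.commute)
  also have "\<dots> \<le> K1" unfolding K1_def
    using x(2) \<rho>0 R K0 Lh T by (intro frac_le) auto
  finally have "norm w * (v \<bullet> g x t) \<le> norm w * K1" by (intro mult_left_mono) auto
  then show ?thesis by (subst v(3)) simp
qed simp

text \<open>Split \<open>e\<close> into its radial part and a tangential remainder of norm at most
  one; the remainder contributes at most \<open>K1\<close>.\<close>

lemma directional_le_radial:
  assumes x: "x \<in> \<Omega>" "\<rho>0 \<le> norm (x - c)" and t: "0 \<le> t" "t < T" and e: "norm e = 1"
  shows "e \<bullet> g x t \<le> (e \<bullet> sgn (x - c)) * (sgn (x - c) \<bullet> g x t) + K1"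
proof -
  define \<nu> where "\<nu> = sgn (x - c)"
  have x0: "x \<noteq> c" using x \<rho>0 by auto
  then have \<nu>: "norm \<nu> = 1" "x - c = norm (x - c) *\<^sub>R \<nu>" by (simp_all add: \<nu>_def norm_sgn sgn_div_norm)
  define w where "w = e - (e \<bullet> \<nu>) *\<^sub>R \<nu>"
  have n2: "\<nu> \<bullet> \<nu> = 1" using \<nu>(1) by (simp add: dot_square_norm)
  have "w \<bullet> \<nu> = 0" by (simp add: w_def inner_diff_left n2)
  then have w: "w \<bullet> (x - c) = 0" by (subst \<nu>(2)) simp
  have "w \<bullet> w = e \<bullet> e - (e \<bullet> \<nu>)\<^sup>2"
    by (simp add: w_def inner_diff_left inner_diff_right n2 inner_commute[of \<nu> e] power2_eq_square)
  then have "(norm w)\<^sup>2 \<le> 1" using e by (simp add: dot_square_norm)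
  then have "norm w \<le> 1" by (simp add: power_le_one_iff abs_square_le_1)
  then have "w \<bullet> g x t \<le> 1 * K1"
    using tangential_bound[OF x t w] K1_nonneg mult_right_mono[of "norm w" 1 K1] by linarith
  then show ?thesis by (simp add: w_def inner_diff_left \<nu>_def)
qed

lemma norm_gradient_le_radial:
  assumes x: "x \<in> \<Omega>" "\<rho>0 \<le> norm (x - c)" and t: "0 \<le> t" "t < T"
  shows "norm (g x t) \<le> \<bar>sgn (x - c) \<bullet> g x t\<bar> + K1"
proof (cases "g x t = 0")
  case False
  define \<nu> where "\<nu> = sgn (x - c)"
  have x0: "x \<noteq> c" using x \<rho>0 by auto
  then have \<nu>: "norm \<nu> = 1" by (simp add: \<nu>_def norm_sgn)
  define e where "e = sgn (g x t)"
  have e: "norm e = 1" using False by (simp add: e_def norm_sgn)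
  have eg: "e \<bullet> g x t = norm (g x t)" using False by (simp add: e_def sgn_div_norm dot_square_norm power2_eq_square)
  have "(e \<bullet> \<nu>) * (\<nu> \<bullet> g x t) \<le> \<bar>e \<bullet> \<nu>\<bar> * \<bar>\<nu> \<bullet> g x t\<bar>" by (simp add: abs_mult[symmetric])
  also have "\<dots> \<le> 1 * \<bar>\<nu> \<bullet> g x t\<bar>"
    using Cauchy_Schwarz_ineq2[of e \<nu>] e \<nu> by (intro mult_right_mono) auto
  finally show ?thesis using directional_le_radial[OF x t e] eg by (simp add: \<nu>_def)
qed (use K1_nonneg in simp)

text \<open>The sign \<open>i\<close> selects the outer sphere (\<open>- 1\<close>) or the inner one (\<open>1\<close>); in both cases
  \<open>i *\<^sub>R sgn (x - c)\<close> is the direction pointing away from that sphere into the shell.\<close>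

definition bdist :: "real \<Rightarrow> 'a \<Rightarrow> real" where
  "bdist i x = (if i < 0 then R - norm (x - c) else norm (x - c) - ra)"

lemma bdist_pos: "x \<in> \<Omega> \<Longrightarrow> 0 < bdist i x"
  by (simp add: bdist_def in_\<Omega>)

lemma far_from_centre: "\<rho>0 \<le> norm (x - c)" if "x \<in> \<Omega>" "bdist i x \<le> s0"
  using core[OF that(1)] that(2) by (cases "i < 0") (auto simp: bdist_def dist_norm norm_minus_commute not_less[symmetric])

text \<open>If the derivative pointing away from the sphere were below \<open>- 1\<close>, uniform
  continuity would keep it negative on the whole radial segment to the sphere. Then \<open>u\<close>
  would increase from a nonnegative value to its boundary value \<open>0\<close>.\<close>

lemma inward_derivative_bound:
  assumes "\<tau> < T"
  obtains \<delta> where "\<delta> > 0" "\<And>x t j. x \<in> \<Omega> \<Longrightarrow> 0 < t \<Longrightarrow> t \<le> \<tau> \<Longrightarrow> j \<in> {-1, 1} \<Longrightarrow> bdist j x \<le> \<delta> \<Longrightarrow>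
    - 1 \<le> j * (sgn (x - c) \<bullet> g x t)"
proof -
  obtain \<eta> where \<eta>: "\<eta> > 0" "\<And>z z'. z \<in> \<Omega> \<times> {0..\<tau>} \<Longrightarrow> z' \<in> \<Omega> \<times> {0..\<tau>} \<Longrightarrow> dist z' z < \<eta> \<Longrightarrow>
      dist ((\<lambda>(x, t). g x t) z') ((\<lambda>(x, t). g x t) z) < 1"
    using gradient_uniformly_continuous[OF assms] unfolding uniformly_continuous_on_def by (metis zero_less_one)
  define \<delta> where "\<delta> = min \<eta> s0 / 2"
  have \<delta>: "\<delta> > 0" "\<delta> < \<eta>" "\<delta> < s0" using \<eta>(1) s0 by (auto simp: \<delta>_def)
  show thesis
  proof (rule that[OF \<delta>(1)], rule ccontr)
    fix x t and j :: real
    assume x: "x \<in> \<Omega>" and t: "0 < t" "t \<le> \<tau>" and j: "j \<in> {-1, 1}" and near: "bdist j x \<le> \<delta>"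
      and "\<not> - 1 \<le> j * (sgn (x - c) \<bullet> g x t)"
    define \<nu> where "\<nu> = sgn (x - c)"
    have neg: "j * (\<nu> \<bullet> g x t) < - 1" using \<open>\<not> _\<close> by (simp add: \<nu>_def)
    define r where "r = norm (x - c)"
    have r: "\<rho>0 \<le> r" using far_from_centre[OF x, of j] near \<delta> by (simp add: r_def)
    then have "x \<noteq> c" using \<rho>0 by (auto simp: r_def)
    then have \<nu>: "norm \<nu> = 1" "x - c = r *\<^sub>R \<nu>" by (simp_all add: \<nu>_def r_def norm_sgn sgn_div_norm)
    \<comment> \<open>The radial segment towards the sphere selected by \<open>j\<close>, reached at
      \<open>s = bdist j x\<close>.\<close>
    define \<gamma> where "\<gamma> s = x - (s * j) *\<^sub>R \<nu>" for s
    define \<sigma> where "\<sigma> = bdist j x"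
    have \<sigma>: "0 < \<sigma>" "\<sigma> \<le> \<delta>" using bdist_pos[OF x] near by (auto simp: \<sigma>_def)
    \<comment> \<open>For a ball there is no inner sphere: \<open>ra \<le> - s0\<close> would push
      \<open>bdist 1 x\<close> above \<delta>.\<close>
    have jra: "0 < ra" if "j = 1"
      using that ra near \<delta> r \<rho>0 by (auto simp: bdist_def r_def)
    have n\<gamma>: "norm (\<gamma> s - c) = r - s * j" if "0 \<le> s" "s \<le> \<sigma>" for s
    proof -
      have "\<gamma> s - c = (r - s * j) *\<^sub>R \<nu>" using \<nu>(2) by (simp add: \<gamma>_def algebra_simps)
      moreover have "0 \<le> r - s * j"
        using that j jra r \<rho>0 by (auto simp: \<sigma>_def bdist_def r_def)
      ultimately show ?thesis using \<nu>(1) by simp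
    qed
    have \<gamma>\<Omega>: "\<gamma> s \<in> \<Omega>" if "0 \<le> s" "s < \<sigma>" for s
      using that x j n\<gamma>[of s] by (auto simp: in_\<Omega> \<sigma>_def bdist_def r_def)
    have bd: "\<gamma> \<sigma> \<in> frontier \<Omega>"
      using n\<gamma>[of \<sigma>] \<sigma> j unfolding frontier
      by (auto simp: \<sigma>_def bdist_def r_def dist_norm norm_minus_commute)
    have \<gamma>cl: "\<gamma> s \<in> closure \<Omega>" if "0 \<le> s" "s \<le> \<sigma>" for s
      using \<gamma>\<Omega>[of s] bd that closure_subset[of \<Omega>] by (cases "s = \<sigma>") (auto simp: frontier_def)
    have "u (\<gamma> 0) t < u (\<gamma> \<sigma>) t"
    proof (rule DERIV_pos_imp_increasing_open[OF \<sigma>(1)])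
      fix s assume s: "0 < s" "s < \<sigma>"
      have "((\<lambda>s. u (\<gamma> s) t) has_derivative (\<lambda>k. (- (k * j) *\<^sub>R \<nu>) \<bullet> g (\<gamma> s) t)) (at s)"
      proof (rule has_derivative_compose[of \<gamma> _ s UNIV "\<lambda>y. u y t"])
        show "(\<gamma> has_derivative (\<lambda>k. - (k * j) *\<^sub>R \<nu>)) (at s)"
          unfolding \<gamma>_def by (auto intro!: derivative_eq_intros)
        show "((\<lambda>y. u y t) has_derivative (\<lambda>v. v \<bullet> g (\<gamma> s) t)) (at (\<gamma> s))"
          using u_grad[OF \<gamma>\<Omega>[of s], of t] s t assms by simp
      qed
      then have d: "((\<lambda>s. u (\<gamma> s) t) has_real_derivative - j * (\<nu> \<bullet> g (\<gamma> s) t)) (at s)"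
        by (rule has_derivative_imp_has_field_derivative) simp
      have "dist (\<gamma> s, t) (x, t) < \<eta>"
        using s \<sigma>(2) \<delta>(2) \<nu>(1) j by (auto simp: dist_Pair_Pair \<gamma>_def dist_norm)
      then have "norm (g (\<gamma> s) t - g x t) < 1"
        using \<eta>(2)[of "(x, t)" "(\<gamma> s, t)"] x \<gamma>\<Omega>[of s] s t by (simp add: dist_norm)
      then have "\<bar>\<nu> \<bullet> (g (\<gamma> s) t - g x t)\<bar> < 1"
        using Cauchy_Schwarz_ineq2[of \<nu> "g (\<gamma> s) t - g x t"] \<nu>(1) by simp
      then have "- j * (\<nu> \<bullet> g (\<gamma> s) t) > 0"
        using neg j by (auto simp: inner_diff_right)
      then show "\<exists>y. ((\<lambda>s. u (\<gamma> s) t) has_real_derivative y) (at s) \<and> 0 < y" using d by blast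
    next
      have "continuous_on {0..\<sigma>} (\<lambda>s. (\<lambda>(x, t). u x t) (\<gamma> s, t))"
        by (rule continuous_on_compose2[OF cont_u])
          (use \<gamma>cl t assms in \<open>auto simp: \<gamma>_def intro!: continuous_intros\<close>)
      then show "continuous_on {0..\<sigma>} (\<lambda>s. u (\<gamma> s) t)" by simp
    qed
    moreover have "u (\<gamma> \<sigma>) t = 0" using bc[OF bd] t assms by simp
    moreover have "0 \<le> u (\<gamma> 0) t" using u_nonneg[of "\<gamma> 0" t] \<gamma>\<Omega>[of 0] \<sigma> t assms by simp
    ultimately show False by simp
  qed
qed

end

text \<open>Here \<open>\<gamma>\<close>, \<open>G\<close> and \<open>\<mu>\<close> will be the directional derivative, the norm of the gradient and the inward
  normal derivative at a touching point. Replacing \<open>\<gamma>\<close> by \<open>\<gamma> - K1\<close> absorbs the tangential part of the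
  gradient, and superadditivity of the power then separates the leading term from \<open>B\<close>, which pays for
  the curvature and for \<open>h\<close>.\<close>

lemma barrier_inequality:
  fixes p A \<gamma> G \<mu> f f1 f2 C0 K1 L B n :: real
  assumes "p > 2" "0 \<le> f" "f1 \<le> 0" "f2 \<le> p * (f + C0) powr (p - 1) * (C0 - f1)" "0 \<le> C0" "0 \<le> K1"
    "\<gamma> \<le> G" "G - K1 \<le> \<mu> \<or> f1 = 0" "f + C0 + B + K1 \<le> \<gamma>" "C0 \<le> A" "1 \<le> A" "n + L + 1 \<le> B" "0 \<le> n" "0 \<le> L"
  shows "f2 - n * f1 + L < p * G powr (p - 2) * (A * \<gamma> - f1 * \<mu>)"
proof -
  \<comment> \<open>A common lower bound for \<open>\<gamma> - K1\<close>, for \<open>G\<close> and,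
    unless \<open>f1 = 0\<close>, for \<mu>; the drift can thus be estimated by powers of
    \<open>y\<close> alone.\<close>
  define y where "y = f + C0 + B"
  have y: "1 \<le> y" "y \<le> \<gamma> - K1" "y \<le> G" using assms by (auto simp: y_def)
  have "B powr 1 \<le> B powr (p - 1)" using assms by (intro powr_mono) auto
  then have Bq: "n + L + 1 \<le> B powr (p - 1)" using assms by simp
  have "y powr (p - 1) * (A - f1) = y powr (p - 2) * (y * (A - f1))"
    using y by (simp add: powr_diff powr_numeral power2_eq_square)
  also have "\<dots> \<le> G powr (p - 2) * (A * \<gamma> - f1 * \<mu>)"
  proof (rule mult_mono)
    show "y powr (p - 2) \<le> G powr (p - 2)" using y assms by (intro powr_mono2) auto
    have "A * y \<le> A * \<gamma>" using y assms by (intro mult_left_mono) auto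
    moreover have "(- f1) * y \<le> (- f1) * \<mu>"
      using y assms(3,6,7,8) by (cases "f1 = 0") (auto intro!: mult_left_mono_neg)
    ultimately show "y * (A - f1) \<le> A * \<gamma> - f1 * \<mu>" by (simp add: algebra_simps)
  qed (use y assms in auto)
  finally have 1: "p * (y powr (p - 1) * (A - f1)) \<le> p * (G powr (p - 2) * (A * \<gamma> - f1 * \<mu>))"
    using assms by (intro mult_left_mono) auto
  have "(f + C0) powr (p - 1) + B powr (p - 1) \<le> y powr (p - 1)"
    unfolding y_def using assms by (intro powr_superadditive) auto
  then have "((f + C0) powr (p - 1) + B powr (p - 1)) * (A - f1) \<le> y powr (p - 1) * (A - f1)"
    using assms by (intro mult_right_mono) auto
  then have 2: "p * (((f + C0) powr (p - 1) + B powr (p - 1)) * (A - f1)) \<le> p * (y powr (p - 1) * (A - f1))"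
    using assms by (intro mult_left_mono) auto
  have "p * ((f + C0) powr (p - 1)) * (C0 - f1) \<le> p * ((f + C0) powr (p - 1)) * (A - f1)"
    using assms by (intro mult_left_mono) auto
  then have 3: "f2 \<le> p * ((f + C0) powr (p - 1)) * (A - f1)" using assms(4) by linarith
  have "(n + L + 1) * (A - f1) \<le> B powr (p - 1) * (A - f1)"
    using Bq assms by (intro mult_right_mono) auto
  also have "\<dots> = 1 * (B powr (p - 1) * (A - f1))" by simp
  also have "\<dots> \<le> p * (B powr (p - 1) * (A - f1))"
    using assms by (intro mult_right_mono) auto
  finally have 4: "(n + L + 1) * (A - f1) \<le> p * (B powr (p - 1) * (A - f1))" .
  \<comment> \<open>The extra \<open>1\<close> makes the inequality strict, because
    \<open>A - f1\<close> is positive.\<close>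
  have "n * (- f1) + L < (n + L + 1) * (A - f1)"
  proof -
    have "L * 1 \<le> L * A" "0 \<le> n * A" "0 \<le> L * (- f1)" "0 < A - f1"
      using assms by (auto intro!: mult_left_mono mult_nonneg_nonneg simp: mult_nonneg_nonpos simp del: mult_1_right)
    then show ?thesis by (simp add: algebra_simps)
  qed
  then show ?thesis using 1 2 3 4 by (simp add: algebra_simps)
qed

subsection \<open>The barrier argument\<close>

lemma isCont_sgn_shift:
  fixes c :: "'a::euclidean_space"
  shows "x \<noteq> c \<Longrightarrow> isCont (\<lambda>x. sgn (x - c)) x"
  unfolding sgn_div_norm by (intro continuous_intros) auto

lemma has_derivative_norm_shift:
  fixes c :: "'a::euclidean_space"
  assumes "x \<noteq> c"
  shows "((\<lambda>x. norm (x - c)) has_derivative (\<lambda>v. v \<bullet> sgn (x - c))) (at x)"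
proof -
  have "((\<lambda>x. x - c) has_derivative (\<lambda>v. v)) (at x)" by (auto intro!: derivative_eq_intros)
  from has_derivative_compose[OF this has_derivative_norm] assms show ?thesis
    by (simp add: inner_commute)
qed

lemma has_derivative_sgn_shift:
  fixes c :: "'a::euclidean_space"
  assumes "x \<noteq> c"
  shows "((\<lambda>x. sgn (x - c)) has_derivative
    (\<lambda>v. (1 / norm (x - c)) *\<^sub>R (v - (v \<bullet> sgn (x - c)) *\<^sub>R sgn (x - c)))) (at x)"
proof -
  have n: "norm (x - c) \<noteq> 0" using assms by simp
  have "((\<lambda>x. x - c) has_derivative (\<lambda>v. v)) (at x)" by (auto intro!: derivative_eq_intros)
  from has_derivative_scaleR[OF Deriv.has_derivative_inverse[OF n has_derivative_norm_shift[OF assms]] this]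
  have "((\<lambda>x. sgn (x - c)) has_derivative (\<lambda>v. inverse (norm (x - c)) *\<^sub>R v
      + - (inverse (norm (x - c)) * (v \<bullet> sgn (x - c)) * inverse (norm (x - c))) *\<^sub>R (x - c))) (at x)"
    by (simp add: sgn_div_norm[abs_def])
  then show ?thesis
    by (rule has_derivative_eq_rhs)
      (simp add: fun_eq_iff sgn_div_norm algebra_simps inverse_eq_divide)
qed

text \<open>The last bound on \<open>A\<close> is a budget, since the linear part is at least
  \<open>A * R\<close>: \<open>K0\<close> excludes the initial time, \<open>K1 + 1\<close> the
  opposite sphere, and \<open>A * R - C0 - K1\<close> must still cover
  \<open>DIM('a) / \<rho>0 + Lh + 1\<close> at a touching point.\<close>

locale hj_barrier = annular_hj p T Lh K0 \<Omega> h u gh g H D c ra R s0 \<rho>0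
  for p T Lh K0 :: real and \<Omega> :: "'a::euclidean_space set" and h u gh g H D c ra R s0 \<rho>0 +
  fixes K \<beta> C0 A :: real and F F' F'' :: "real \<Rightarrow> real"
  assumes K: "0 < K" and \<beta>: "0 < \<beta>" and C0: "0 \<le> C0"
    and dF: "\<And>s. s > 0 \<Longrightarrow> (F has_real_derivative F' s) (at s)"
    and dF': "\<And>s. s > 0 \<Longrightarrow> (F' has_real_derivative F'' s) (at s)"
    and cF'': "continuous_on {0<..} F''"
    and F_nonneg: "\<And>s. s > 0 \<Longrightarrow> 0 \<le> F s"
    and F'_nonpos: "\<And>s. s > 0 \<Longrightarrow> F' s \<le> 0"
    and F''_le: "\<And>s. s > 0 \<Longrightarrow> F'' s \<le> p * (F s + C0) powr (p - 1) * (C0 - F' s)"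
    and F_lower: "\<And>s. s > 0 \<Longrightarrow> K * s powr (- \<beta>) \<le> F s + C0"
    and F_zero: "\<And>s. s \<ge> s0 \<Longrightarrow> F s = 0"
    and A: "C0 \<le> A" "1 \<le> A" "C0 + 2 * K1 + K0 + DIM('a) / \<rho>0 + Lh + 2 \<le> A * R"
begin

text \<open>The constant \<open>2 * R\<close> keeps the value between \<open>A * R\<close> and
  \<open>3 * A * R\<close> on the shell for unit \<open>e\<close>; the slope - A e makes the drift
  act downwards.\<close>

definition lin :: "'a \<Rightarrow> 'a \<Rightarrow> real" where
  "lin e x = A * (2 * R - e \<bullet> (x - c))"

lemma lin_lower: "A * R \<le> lin e x" if "norm e = 1" "x \<in> \<Omega>"
proof -
  have "e \<bullet> (x - c) \<le> norm e * norm (x - c)" by (rule norm_cauchy_schwarz)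
  then have "R \<le> 2 * R - e \<bullet> (x - c)" using that by (simp add: in_\<Omega>)
  then show ?thesis unfolding lin_def using A by (intro mult_left_mono) auto
qed

lemma AR: "K1 + 1 < A * R" "K0 < A * R"
proof -
  have "0 \<le> DIM('a) / \<rho>0" using \<rho>0 by simp
  then show "K1 + 1 < A * R" "K0 < A * R" using A(3) C0 K1_nonneg K0 Lh by linarith+
qed

lemma has_derivative_lin: "(lin e has_derivative (\<lambda>v. v \<bullet> (- A *\<^sub>R e))) (at x)"
  unfolding lin_def[abs_def] by (auto intro!: derivative_eq_intros simp: inner_commute)

lemma has_derivative_bdist:
  assumes "x \<noteq> c" "i \<in> {-1, 1}"
  shows "(bdist i has_derivative (\<lambda>v. i * (v \<bullet> sgn (x - c)))) (at x)"
  using assms(2) has_derivative_norm_shift[OF assms(1)]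
  unfolding bdist_def[abs_def] by (auto intro!: derivative_eq_intros)

definition bgrad :: "real \<Rightarrow> 'a \<Rightarrow> 'a" where
  "bgrad i x = (i * F' (bdist i x)) *\<^sub>R sgn (x - c)"

text \<open>Radial second derivative plus the tangential projection weighted by the curvature of the
  spheres. The first summand carries no \<open>i\<close> because \<open>i\<close> squared is
  one.\<close>

definition bhess :: "real \<Rightarrow> 'a \<Rightarrow> 'a \<Rightarrow> 'a" where
  "bhess i x v = (F'' (bdist i x) * (v \<bullet> sgn (x - c))) *\<^sub>R sgn (x - c)
     + (i * F' (bdist i x) / norm (x - c)) *\<^sub>R (v - (v \<bullet> sgn (x - c)) *\<^sub>R sgn (x - c))"

lemma has_derivative_radial_barrier:
  assumes "x \<noteq> c" "i \<in> {-1, 1}" "0 < bdist i x"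
  shows "((\<lambda>x. F (bdist i x)) has_derivative (\<lambda>v. v \<bullet> bgrad i x)) (at x)"
  using has_derivative_compose[OF has_derivative_bdist[OF assms(1,2)]
      dF[OF assms(3), unfolded has_field_derivative_def]]
  by (simp add: bgrad_def algebra_simps)

lemma has_derivative_bgrad:
  assumes "x \<noteq> c" "i \<in> {-1, 1}" "0 < bdist i x"
  shows "(bgrad i has_derivative bhess i x) (at x)"
proof -
  have "((\<lambda>x. i * F' (bdist i x)) has_derivative (\<lambda>v. i * (F'' (bdist i x) * (i * (v \<bullet> sgn (x - c)))))) (at x)"
    using has_derivative_compose[OF has_derivative_bdist[OF assms(1,2)]
      dF'[OF assms(3), unfolded has_field_derivative_def]] by (rule has_derivative_mult_right)
  then have "((\<lambda>x. i * F' (bdist i x)) has_derivative (\<lambda>v. F'' (bdist i x) * (v \<bullet> sgn (x - c)))) (at x)"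
    by (rule has_derivative_eq_rhs) (use assms(2) in auto)
  from has_derivative_scaleR[OF this has_derivative_sgn_shift[OF assms(1)]]
  show ?thesis unfolding bgrad_def[abs_def] bhess_def
    by (rule has_derivative_eq_rhs) (simp add: fun_eq_iff add.commute)
qed

lemma trace_bhess:
  "(\<Sum>b\<in>Basis. bhess i x b \<bullet> b) = F'' (bdist i x) * (sgn (x - c) \<bullet> sgn (x - c))
     + i * F' (bdist i x) / norm (x - c) * (DIM('a) - sgn (x - c) \<bullet> sgn (x - c))"
proof -
  define s k where "s = sgn (x - c)" and "k = i * F' (bdist i x) / norm (x - c)"
  have "(\<Sum>b\<in>Basis. bhess i x b \<bullet> b) = (\<Sum>b\<in>Basis. F'' (bdist i x) * ((s \<bullet> b) * (s \<bullet> b))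
     + k * (1 - (s \<bullet> b) * (s \<bullet> b)))"
    unfolding bhess_def s_def[symmetric] k_def[symmetric]
    by (intro sum.cong refl) (simp add: inner_add_left inner_diff_left inner_commute[of s])
  also have "\<dots> = F'' (bdist i x) * (s \<bullet> s) + k * (DIM('a) - s \<bullet> s)"
    unfolding euclidean_inner[of s s]
    by (simp add: sum.distrib sum_subtractf sum_distrib_left[symmetric])
  finally show ?thesis by (simp add: s_def k_def)
qed

lemma isCont_trace_bhess:
  assumes "x \<noteq> c" "i \<in> {-1, 1}" "0 < bdist i x"
  shows "isCont (\<lambda>x. \<Sum>b\<in>Basis. bhess i x b \<bullet> b) x"
proof -
  have b: "isCont (bdist i) x" using has_derivative_bdist[OF assms(1,2)] by (rule has_derivative_continuous)
  have "isCont F'' (bdist i x)" using cF'' assms(3) by (simp add: continuous_on_eq_continuous_at)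
  then have "isCont (\<lambda>x. F'' (bdist i x)) x" using b by (rule isCont_o2[rotated])
  moreover have "isCont (\<lambda>x. F' (bdist i x)) x" using b DERIV_isCont[OF dF'[OF assms(3)]] by (rule isCont_o2)
  ultimately show ?thesis unfolding trace_bhess
    using isCont_sgn_shift[OF assms(1)] assms(1) by (auto intro!: continuous_intros)
qed

text \<open>The case of the core around the centre, where \<open>sgn (x - c)\<close> may be singular
  but the radial part of the barrier vanishes.\<close>

lemma linear_barrier_not_touched:
  assumes x0: "x0 \<in> \<Omega>" and t0: "0 < t0" "t0 < T" and e: "norm e = 1" and "\<delta> > 0"
    and above: "lin e x0 \<le> e \<bullet> g x0 t0"
    and max: "\<And>x t. x \<in> ball x0 \<delta> \<Longrightarrow> x \<in> \<Omega> \<Longrightarrow> 0 < t \<Longrightarrow> t \<le> t0 \<Longrightarrow>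
      e \<bullet> g x t - lin e x \<le> e \<bullet> g x0 t0 - lin e x0"
  shows False
proof -
  have "0 \<le> (\<Sum>b\<in>Basis. (0::'a) \<bullet> b) + p * norm (g x0 t0) powr (p - 2) * (g x0 t0 \<bullet> (- A *\<^sub>R e)) + Lh"
    by (rule directional_derivative_touching[OF x0 t0 e \<open>\<delta> > 0\<close>, where Z = "lin e" and HZ = "\<lambda>_ _. 0"])
      (rule has_derivative_lin has_derivative_const max continuous_const | assumption | simp)+
  \<comment> \<open>The product \<open>0 * 0\<close> keeps the shape of
    \<open>barrier_inequality\<close> with vanishing radial slope and normal derivative.\<close>
  then have "p * norm (g x0 t0) powr (p - 2) * (A * (e \<bullet> g x0 t0) - 0 * 0) \<le> Lh"
    by (simp add: inner_commute algebra_simps)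
  moreover have "0 - 0 * 0 + Lh < p * norm (g x0 t0) powr (p - 2) * (A * (e \<bullet> g x0 t0) - 0 * 0)"
  proof (rule barrier_inequality[where f = 0 and ?C0.0 = C0 and ?K1.0 = K1 and B = "A * R - C0 - K1"])
    show "e \<bullet> g x0 t0 \<le> norm (g x0 t0)" using norm_cauchy_schwarz[of e "g x0 t0"] e by simp
    show "0 + C0 + (A * R - C0 - K1) + K1 \<le> e \<bullet> g x0 t0" using lin_lower[OF e x0] above by simp
    have "0 \<le> DIM('a) / \<rho>0" using \<rho>0 by simp
    then show "0 + Lh + 1 \<le> A * R - C0 - K1" using A(3) K0 K1_nonneg by linarith
    show "0 \<le> p * (0 + C0) powr (p - 1) * (C0 - 0)" using p C0 by simp
  qed (use p C0 K1_nonneg A Lh in auto)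
  ultimately show False by simp
qed

lemma radial_barrier_not_touched:
  assumes x0: "x0 \<in> \<Omega>" and t0: "0 < t0" "t0 < T" and e: "norm e = 1" and "\<delta> > 0"
    and i: "i \<in> {-1, 1}" and far: "\<rho>0 \<le> norm (x0 - c)" and side: "0 < i * (e \<bullet> (x0 - c))"
    and above: "lin e x0 + F (bdist i x0) \<le> e \<bullet> g x0 t0"
    and max: "\<And>x t. x \<in> ball x0 \<delta> \<Longrightarrow> x \<in> \<Omega> \<Longrightarrow> 0 < t \<Longrightarrow> t \<le> t0 \<Longrightarrow>
      e \<bullet> g x t - (lin e x + F (bdist i x)) \<le> e \<bullet> g x0 t0 - (lin e x0 + F (bdist i x0))"
  shows False
proof -
  define \<nu> m f f1 f2 where "\<nu> = sgn (x0 - c)" and "m = \<nu> \<bullet> g x0 t0" and "f = F (bdist i x0)"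
    and "f1 = F' (bdist i x0)" and "f2 = F'' (bdist i x0)"
  have x0c: "x0 \<noteq> c" using far \<rho>0 by auto
  then have \<nu>: "\<nu> \<bullet> \<nu> = 1" by (simp add: \<nu>_def dot_square_norm norm_sgn)
  have b0: "0 < bdist i x0" by (rule bdist_pos[OF x0])
  obtain \<delta>' where \<delta>': "\<delta>' > 0" "\<delta>' \<le> \<delta>" "ball x0 \<delta>' \<subseteq> \<Omega> - {c}"
  proof -
    have "open (\<Omega> - {c})" using open_\<Omega> by (simp add: open_delete)
    then obtain d where "d > 0" "ball x0 d \<subseteq> \<Omega> - {c}" using x0 x0c open_contains_ball by blast
    moreover have "ball x0 (min d \<delta>) \<subseteq> ball x0 d" by (rule subset_ball) simp
    ultimately show thesis using that[of "min d \<delta>"] \<open>\<delta> > 0\<close> by auto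
  qed
  have "0 \<le> (\<Sum>b\<in>Basis. (0 + bhess i x0 b) \<bullet> b)
      + p * norm (g x0 t0) powr (p - 2) * (g x0 t0 \<bullet> (- A *\<^sub>R e + bgrad i x0)) + Lh"
  proof (rule directional_derivative_touching[OF x0 t0 e \<open>\<delta>' > 0\<close>, where Z = "\<lambda>x. lin e x + F (bdist i x)"
        and gZ = "\<lambda>x. - A *\<^sub>R e + bgrad i x" and HZ = "\<lambda>x v. 0 + bhess i x v"])
    fix x assume "x \<in> ball x0 \<delta>'"
    then have x: "x \<in> \<Omega>" "x \<noteq> c" using \<delta>' by auto
    show "((\<lambda>x. lin e x + F (bdist i x)) has_derivative (\<lambda>v. v \<bullet> (- A *\<^sub>R e + bgrad i x))) (at x)"
      unfolding inner_add_right
      by (intro has_derivative_add has_derivative_lin has_derivative_radial_barrier x i bdist_pos)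
    show "((\<lambda>x. - A *\<^sub>R e + bgrad i x) has_derivative (\<lambda>v. 0 + bhess i x v)) (at x)"
      by (intro has_derivative_add has_derivative_const has_derivative_bgrad x i bdist_pos)
  next
    show "isCont (\<lambda>x. \<Sum>b\<in>Basis. (0 + bhess i x b) \<bullet> b) x0"
      using isCont_trace_bhess[OF x0c i b0] by simp
  qed (use max \<delta>' in auto)
  moreover have "g x0 t0 \<bullet> (- A *\<^sub>R e + bgrad i x0) = - (A * (e \<bullet> g x0 t0) - f1 * (i * m))"
    by (simp add: bgrad_def inner_diff_right f1_def m_def \<nu>_def inner_commute)
  \<comment> \<open>The curvature term has either sign depending on \<open>i\<close>; bounding it by
    \<open>- f1\<close> times \<open>DIM('a) / \<rho>0\<close> covers both spheres.\<close>
  moreover have "(\<Sum>b\<in>Basis. (0 + bhess i x0 b) \<bullet> b) \<le> f2 - DIM('a) / \<rho>0 * f1"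
  proof -
    have f1: "f1 \<le> 0" unfolding f1_def by (rule F'_nonpos[OF b0])
    have D1: "0 \<le> real DIM('a) - 1" by simp
    have "i * f1 * ((real DIM('a) - 1) / norm (x0 - c)) \<le> (- f1) * (DIM('a) / \<rho>0)"
    proof (rule mult_mono)
      show "(real DIM('a) - 1) / norm (x0 - c) \<le> DIM('a) / \<rho>0"
        using far \<rho>0 by (intro frac_le) auto
    qed (use i f1 D1 in auto)
    then show ?thesis using \<nu> by (simp add: trace_bhess f1_def f2_def \<nu>_def algebra_simps)
  qed
  moreover have "f2 - DIM('a) / \<rho>0 * f1 + Lh
      < p * norm (g x0 t0) powr (p - 2) * (A * (e \<bullet> g x0 t0) - f1 * (i * m))"
  proof (rule barrier_inequality[where f = f and ?C0.0 = C0 and ?K1.0 = K1 and B = "A * R - C0 - K1"])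
    show "e \<bullet> g x0 t0 \<le> norm (g x0 t0)" using norm_cauchy_schwarz[of e "g x0 t0"] e by simp
    show "f + C0 + (A * R - C0 - K1) + K1 \<le> e \<bullet> g x0 t0"
      using lin_lower[OF e x0] above by (simp add: f_def)
    have f: "0 \<le> f" unfolding f_def by (rule F_nonneg[OF b0])
    show "DIM('a) / \<rho>0 + Lh + 1 \<le> A * R - C0 - K1" using A(3) K0 K1_nonneg by linarith
    \<comment> \<open>A derivative above the tangential bound forces the radial product to be
      positive. The normal derivative \<open>m\<close> then has the sign of \<open>i\<close>, so
      \<open>i * m\<close> is its absolute value and is close to the full gradient norm.\<close>
    have "K1 < e \<bullet> g x0 t0" using AR(1) lin_lower[OF e x0] above f by (simp add: f_def)
    then have pos: "0 < (e \<bullet> \<nu>) * m"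
      using directional_le_radial[OF x0 far _ t0(2) e] t0(1) by (simp add: \<nu>_def m_def)
    have "e \<bullet> (x0 - c) = norm (x0 - c) * (e \<bullet> \<nu>)" using x0c by (simp add: \<nu>_def sgn_div_norm)
    then have "0 < norm (x0 - c) * (i * (e \<bullet> \<nu>))" using side by (simp add: algebra_simps)
    then have "0 < i * (e \<bullet> \<nu>)" using x0c by (simp add: zero_less_mult_iff)
    then have "i * m = \<bar>m\<bar>" using pos i by (auto simp: zero_less_mult_iff)
    then show "norm (g x0 t0) - K1 \<le> i * m \<or> f1 = 0"
      using norm_gradient_le_radial[OF x0 far _ t0(2)] t0(1) by (simp add: m_def \<nu>_def)
    show "0 \<le> f" by (rule f)
  qed (use p C0 K1_nonneg A Lh \<rho>0 F'_nonpos[OF b0] F''_le[OF b0] in \<open>auto simp: f_def f1_def f2_def\<close>)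
  ultimately show False by (simp add: right_diff_distrib)
qed

text \<open>Near the sphere selected by \<open>i\<close> the radial part exceeds the gradient bound
  on \<open>(0, \<tau>]\<close>. Near the other sphere \<open>e\<close> has no inward component, and
  the inward derivative bound limits \<open>e \<bullet> g x t\<close> to
  \<open>K1 + 1\<close>.\<close>

lemma barrier_above_near_boundary:
  assumes \<tau>: "\<tau> < T"
  obtains \<delta> where "\<delta> > 0" "\<And>e x t i j. norm e = 1 \<Longrightarrow> x \<in> \<Omega> \<Longrightarrow> 0 < t \<Longrightarrow> t \<le> \<tau> \<Longrightarrow> i \<in> {-1, 1} \<Longrightarrow>
    j \<in> {-1, 1} \<Longrightarrow> 0 \<le> i * (e \<bullet> (x - c)) \<Longrightarrow> bdist j x \<le> \<delta> \<Longrightarrow> e \<bullet> g x t \<le> lin e x + F (bdist i x)"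
proof -
  obtain M where M: "\<And>x t. x \<in> \<Omega> \<Longrightarrow> 0 \<le> t \<Longrightarrow> t \<le> \<tau> \<Longrightarrow> norm (g x t) \<le> M"
    using gradient_bounded[OF \<tau>] by blast
  obtain \<delta>1 where \<delta>1: "\<delta>1 > 0" "\<And>x t j. x \<in> \<Omega> \<Longrightarrow> 0 < t \<Longrightarrow> t \<le> \<tau> \<Longrightarrow> j \<in> {-1, 1} \<Longrightarrow> bdist j x \<le> \<delta>1 \<Longrightarrow>
    - 1 \<le> j * (sgn (x - c) \<bullet> g x t)"
    using inward_derivative_bound[OF \<tau>] by blast
  \<comment> \<open>Chosen so that the lower bound for \<open>F\<close>, evaluated at
    \<open>\<delta>2 = B powr (- 1 / \<beta>)\<close>, exceeds \<open>M\<close>.\<close>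
  define B where "B = (\<bar>M\<bar> + C0 + 1) / K"
  have B: "B > 0" using K C0 by (simp add: B_def)
  define \<delta>2 where "\<delta>2 = B powr (- 1 / \<beta>)"
  have \<delta>2: "\<delta>2 > 0" using B by (simp add: \<delta>2_def)
  have FM: "M \<le> F s" if "0 < s" "s \<le> \<delta>2" for s
  proof -
    have "B = \<delta>2 powr (- \<beta>)" using B \<beta> by (simp add: \<delta>2_def powr_powr)
    also have "\<dots> \<le> s powr (- \<beta>)" using that \<beta> by (intro powr_mono2') auto
    finally have "K * B \<le> K * s powr (- \<beta>)" using K by simp
    also have "\<dots> \<le> F s + C0" by (rule F_lower[OF that(1)])
    finally show ?thesis using K by (simp add: B_def)
  qed
  show thesis
  proof (rule that[of "min (min \<delta>1 \<delta>2) s0"])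
    fix e x t and i j :: real
    assume e: "norm e = 1" and x: "x \<in> \<Omega>" and t: "0 < t" "t \<le> \<tau>" and i: "i \<in> {-1, 1}" and j: "j \<in> {-1, 1}"
      and side: "0 \<le> i * (e \<bullet> (x - c))" and near: "bdist j x \<le> min (min \<delta>1 \<delta>2) s0"
    have lin: "0 \<le> lin e x" "A * R \<le> lin e x"
      using lin_lower[OF e x] AR K0 by auto
    have Fn: "0 \<le> F (bdist i x)" by (rule F_nonneg[OF bdist_pos[OF x]])
    show "e \<bullet> g x t \<le> lin e x + F (bdist i x)"
    proof (cases "i = j")
      case True
      have "e \<bullet> g x t \<le> norm (g x t)" using norm_cauchy_schwarz[of e "g x t"] e by simp
      also have "\<dots> \<le> M" using M x t by auto
      also have "\<dots> \<le> F (bdist i x)" using FM[OF bdist_pos[OF x]] near True by auto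
      finally show ?thesis using lin by simp
    next
      case False
      then have ij: "i = - j" using i j by auto
      define \<nu> where "\<nu> = sgn (x - c)"
      have far: "\<rho>0 \<le> norm (x - c)" using far_from_centre[OF x, of j] near by simp
      then have xc: "x \<noteq> c" using \<rho>0 by auto
      have "e \<bullet> (x - c) = norm (x - c) * (e \<bullet> \<nu>)" using xc by (simp add: \<nu>_def sgn_div_norm)
      then have "0 \<le> norm (x - c) * (i * (e \<bullet> \<nu>))" using side by (simp add: algebra_simps)
      then have s1: "0 \<le> i * (e \<bullet> \<nu>)" using xc by (simp add: zero_le_mult_iff)
      have "\<bar>e \<bullet> \<nu>\<bar> \<le> 1" using Cauchy_Schwarz_ineq2[of e \<nu>] e xc by (simp add: \<nu>_def norm_sgn)
      then have s2: "i * (e \<bullet> \<nu>) \<le> 1" using i by auto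
      have "- 1 \<le> j * (\<nu> \<bullet> g x t)" using \<delta>1(2)[OF x t j] near by (simp add: \<nu>_def)
      then have "(i * (e \<bullet> \<nu>)) * (- (j * (\<nu> \<bullet> g x t))) \<le> (i * (e \<bullet> \<nu>)) * 1" using s1 by (intro mult_left_mono) auto
      moreover have "(i * (e \<bullet> \<nu>)) * (- (j * (\<nu> \<bullet> g x t))) = (e \<bullet> \<nu>) * (\<nu> \<bullet> g x t)"
        using j ij by auto
      ultimately have "(e \<bullet> \<nu>) * (\<nu> \<bullet> g x t) \<le> 1" using s2 by simp
      then have "e \<bullet> g x t \<le> 1 + K1"
        using directional_le_radial[OF x far _ _ e, of t] t \<tau> by (simp add: \<nu>_def)
      then show ?thesis using AR(1) lin(2) Fn by simp
    qed
  qed (use \<delta>1 \<delta>2 s0 in auto)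
qed

text \<open>A positive maximum of the excess has nowhere to sit: the layer of width \<delta>
  excludes the spheres, \<open>K0 < A * R\<close> the initial time, the tangential bound the
  separating plane outside the core, and the two touching lemmas the rest.\<close>

lemma directional_derivative_le_barrier:
  assumes e: "norm e = 1" and "x \<in> \<Omega>" "0 < t" "t < T" "i \<in> {-1, 1}" "0 \<le> i * (e \<bullet> (x - c))"
  shows "e \<bullet> g x t \<le> lin e x + F (bdist i x)"
proof (rule ccontr)
  assume "\<not> ?thesis"
  obtain \<delta> where \<delta>: "\<delta> > 0" "\<And>x s i j. x \<in> \<Omega> \<Longrightarrow> 0 < s \<Longrightarrow> s \<le> t \<Longrightarrow> i \<in> {-1, 1} \<Longrightarrow>
    j \<in> {-1, 1} \<Longrightarrow> 0 \<le> i * (e \<bullet> (x - c)) \<Longrightarrow> bdist j x \<le> \<delta> \<Longrightarrow> e \<bullet> g x s \<le> lin e x + F (bdist i x)"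
    using barrier_above_near_boundary[OF \<open>t < T\<close>] e by metis
  \<comment> \<open>The barrier jumps across the plane \<open>e \<bullet> (x - c) = 0\<close>. Carrying the side \<open>i\<close> as a coordinate makes
    the function to be maximised continuous on a compact set.\<close>
  define X where "X = {x. \<delta> \<le> R - norm (x - c) \<and> \<delta> \<le> norm (x - c) - ra}"
  define S where "S = {z. 0 \<le> snd (snd z) * (e \<bullet> (fst z - c))} \<inter> (X \<times> {0..t} \<times> {-1, 1::real})"
  \<comment> \<open>The weights are \<open>0\<close> and \<open>1\<close> at the two admissible
    values of \<open>i\<close>, so the sum selects one profile while staying continuous in all
    variables.\<close>
  define W where "W = (\<lambda>(x, s, i). e \<bullet> g x s - lin e x
     - ((1 - i) / 2 * F (R - norm (x - c)) + (1 + i) / 2 * F (norm (x - c) - ra)))"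
  have X\<Omega>: "x \<in> \<Omega>" if "x \<in> X" for x using that \<delta>(1) by (auto simp: X_def in_\<Omega>)
  have W: "W (x, s, i) = e \<bullet> g x s - (lin e x + F (bdist i x))" if "i \<in> {-1, 1}" for x s i
    using that by (auto simp: W_def bdist_def)
  have X_bdist: "x \<in> X \<longleftrightarrow> (\<forall>j\<in>{-1, 1}. \<delta> \<le> bdist j x)" for x
    by (auto simp: X_def bdist_def)
  have "closed X" unfolding X_def
    by (intro closed_Collect_conj closed_Collect_le continuous_intros)
  moreover have "bounded X" using bounded_\<Omega> X\<Omega> by (meson bounded_subset subsetI)
  ultimately have "compact X" by (simp add: compact_eq_bounded_closed)
  then have "compact S" unfolding S_def
    by (intro closed_Int_compact compact_Times closed_Collect_le continuous_intros) auto
  moreover have "continuous_on S W"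
  proof -
    have "continuous_on (\<Omega> \<times> {0..t}) (\<lambda>(x, t). g x t)"
      by (rule uniformly_continuous_imp_continuous[OF gradient_uniformly_continuous[OF \<open>t < T\<close>]])
    then have 1: "continuous_on S (\<lambda>z. (\<lambda>(x, t). g x t) (fst z, fst (snd z)))"
      by (rule continuous_on_compose2) (auto simp: S_def X\<Omega> intro!: continuous_intros)
    have cF: "continuous_on {0<..} F"
      by (intro continuous_at_imp_continuous_on ballI DERIV_isCont[OF dF]) auto
    have 2: "continuous_on S (\<lambda>z. F (R - norm (fst z - c)))" "continuous_on S (\<lambda>z. F (norm (fst z - c) - ra))"
      by (rule continuous_on_compose2[OF cF]; use X\<Omega> in \<open>auto simp: S_def in_\<Omega> intro!: continuous_intros\<close>)+
    show ?thesis unfolding W_def lin_def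
      using 1 2 by (auto simp: split_beta' intro!: continuous_intros)
  qed
  moreover have Wx: "0 < W (x, t, i)" using \<open>\<not> _\<close> W assms(5) by simp
  moreover have "(x, t, i) \<in> S"
  proof -
    have "\<delta> \<le> bdist j x" if "j \<in> {-1, 1}" for j
      using \<delta>(2)[OF \<open>x \<in> \<Omega>\<close> \<open>0 < t\<close> order_refl assms(5) that assms(6)] \<open>\<not> _\<close> by force
    then show ?thesis using X_bdist assms by (auto simp: S_def)
  qed
  ultimately obtain z0 where z0: "z0 \<in> S" and Wmax: "\<And>z. z \<in> S \<Longrightarrow> W z \<le> W z0"
    using continuous_attains_sup[of S W] by blast
  obtain x0 t0 i0 where zt: "z0 = (x0, t0, i0)" by (cases z0)
  have x0: "x0 \<in> \<Omega>" and t0: "0 \<le> t0" "t0 \<le> t" "t0 < T" and i0: "i0 \<in> {-1, 1}"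
    and side: "0 \<le> i0 * (e \<bullet> (x0 - c))"
    using z0 zt X\<Omega> \<open>t < T\<close> by (auto simp: S_def)
  have W0: "0 < e \<bullet> g x0 t0 - (lin e x0 + F (bdist i0 x0))"
    using Wmax[OF \<open>(x, t, i) \<in> S\<close>] Wx W[OF i0] zt by simp
  have Fn: "0 \<le> F (bdist i0 x0)" by (rule F_nonneg[OF bdist_pos[OF x0]])
  have big: "A * R < e \<bullet> g x0 t0" using W0 Fn lin_lower[OF e x0] by simp
  have t0pos: "0 < t0"
  proof (rule ccontr)
    assume "\<not> 0 < t0"
    then have "t0 = 0" using t0 by simp
    then have "e \<bullet> g x0 t0 \<le> K0" using norm_cauchy_schwarz[of e "g x0 0"] e g0_bound[OF x0] by simp
    then show False using big AR by simp
  qed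
  have inner: "\<delta> < bdist j x0" if "j \<in> {-1, 1}" for j
    using \<delta>(2)[OF x0 t0pos t0(2) i0 that side] W0 by force
  have oX: "open {x. \<delta> < R - norm (x - c) \<and> \<delta> < norm (x - c) - ra}"
    by (intro open_Collect_conj open_Collect_less continuous_intros)
  have inner': "x0 \<in> {x. \<delta> < R - norm (x - c) \<and> \<delta> < norm (x - c) - ra}"
    using inner[of "-1"] inner[of 1] by (simp add: bdist_def)
  show False
  proof (cases "norm (x0 - c) < \<rho>0")
    case True
    have "open ({x. \<delta> < R - norm (x - c) \<and> \<delta> < norm (x - c) - ra} \<inter> {x. norm (x - c) < \<rho>0})"
      by (intro open_Int oX open_Collect_less continuous_intros)
    then obtain d where d: "d > 0" "ball x0 d \<subseteq> {x. \<delta> < R - norm (x - c) \<and> \<delta> < norm (x - c) - ra} \<inter> {x. norm (x - c) < \<rho>0}"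
      using inner' True open_contains_ball by blast
    have F0: "F (bdist i y) = 0" if "y \<in> \<Omega>" "norm (y - c) < \<rho>0" for y i
      using core[OF that(1)] that(2) F_zero by (auto simp: bdist_def dist_norm norm_minus_commute)
    show False
    proof (rule linear_barrier_not_touched[OF x0 t0pos t0(3) e d(1)])
      show "lin e x0 \<le> e \<bullet> g x0 t0" using W0 Fn by simp
      fix y s assume y: "y \<in> ball x0 d" "y \<in> \<Omega>" and s: "0 < s" "s \<le> t0"
      \<comment> \<open>Any admissible side will do: in the core both profiles are zero, so there is
        no jump.\<close>
      define k :: real where "k = (if 0 \<le> e \<bullet> (y - c) then 1 else -1)"
      have "(y, s, k) \<in> S" using y d s t0 by (auto simp: S_def X_def k_def)
      from Wmax[OF this] show "e \<bullet> g y s - lin e y \<le> e \<bullet> g x0 t0 - lin e x0"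
        using W[of k] W[OF i0] zt F0[OF y(2)] F0[OF x0 True] y d by (auto simp: k_def)
    qed
  next
    case False
    then have far: "\<rho>0 \<le> norm (x0 - c)" by simp
    \<comment> \<open>On the plane \<open>e\<close> is tangential, so the derivative is at most
      \<open>K1\<close>, below \<open>A * R\<close>. Hence a whole neighbourhood of
      \<open>x0\<close> lies on one side.\<close>
    have "e \<bullet> (x0 - c) \<noteq> 0"
    proof
      assume "e \<bullet> (x0 - c) = 0"
      from this have "e \<bullet> g x0 t0 \<le> K1" using tangential_bound[OF x0 far t0(1,3), of e] e by simp
      then show False using big AR(1) by simp
    qed
    then have side': "0 < i0 * (e \<bullet> (x0 - c))" using side i0 by auto
    have "open ({x. \<delta> < R - norm (x - c) \<and> \<delta> < norm (x - c) - ra} \<inter> {x. 0 < i0 * (e \<bullet> (x - c))})"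
      by (intro open_Int oX open_Collect_less continuous_intros)
    then obtain d where d: "d > 0" "ball x0 d \<subseteq> {x. \<delta> < R - norm (x - c) \<and> \<delta> < norm (x - c) - ra} \<inter> {x. 0 < i0 * (e \<bullet> (x - c))}"
      using inner' side' open_contains_ball by blast
    show False
    proof (rule radial_barrier_not_touched[OF x0 t0pos t0(3) e d(1) i0 far side'])
      show "lin e x0 + F (bdist i0 x0) \<le> e \<bullet> g x0 t0" using W0 by simp
      fix y s assume y: "y \<in> ball x0 d" "y \<in> \<Omega>" and s: "0 < s" "s \<le> t0"
      have "y \<in> {x. \<delta> < R - norm (x - c) \<and> \<delta> < norm (x - c) - ra} \<inter> {x. 0 < i0 * (e \<bullet> (x - c))}"
        using d(2) y(1) by (rule subsetD)
      then have "(y, s, i0) \<in> S" using s t0 i0 by (simp add: S_def X_def)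
      from Wmax[OF this] show "e \<bullet> g y s - (lin e y + F (bdist i0 y)) \<le> e \<bullet> g x0 t0 - (lin e x0 + F (bdist i0 x0))"
        using W[OF i0] zt by simp
    qed
  qed
qed

lemma gradient_le_barrier:
  assumes x: "x \<in> \<Omega>" and t: "0 < t" "t < T"
  shows "\<exists>i\<in>{-1, 1}. norm (g x t) \<le> 3 * A * R + F (bdist i x)"
proof (cases "g x t = 0")
  case True
  then show ?thesis using F_nonneg[OF bdist_pos[OF x, of 1]] A R by (auto intro!: bexI[of _ 1])
next
  case False
  define e where "e = sgn (g x t)"
  have e: "norm e = 1" using False by (simp add: e_def norm_sgn)
  have eg: "e \<bullet> g x t = norm (g x t)" using False by (simp add: e_def sgn_div_norm dot_square_norm power2_eq_square)
  define i :: real where "i = (if 0 \<le> e \<bullet> (x - c) then 1 else -1)"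
  have i: "i \<in> {-1, 1}" "0 \<le> i * (e \<bullet> (x - c))" by (auto simp: i_def)
  have "- (e \<bullet> (x - c)) \<le> norm (x - c)"
    using Cauchy_Schwarz_ineq2[of e "x - c"] e by simp
  then have "lin e x \<le> A * (3 * R)"
    unfolding lin_def using A x by (intro mult_left_mono) (auto simp: in_\<Omega>)
  then have "norm (g x t) \<le> 3 * A * R + F (bdist i x)"
    using directional_derivative_le_barrier[OF e x t i] eg by simp
  then show ?thesis using i(1) by blast
qed

end

subsection \<open>The gradient estimate\<close>

lemma exists_on_sphere_same_ray:
  fixes c x :: "'a::euclidean_space"
  assumes "0 < \<rho>"
  obtains y where "dist c y = \<rho>" "dist x y = \<bar>norm (x - c) - \<rho>\<bar>"
proof (cases "x = c")
  case True
  obtain b :: 'a where "norm b = 1" using norm_Basis nonempty_Basis by blast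
  then show thesis using that[of "c + \<rho> *\<^sub>R b"] True assms by (simp add: dist_norm)
next
  case False
  define y where "y = c + \<rho> *\<^sub>R sgn (x - c)"
  have "x - y = (norm (x - c) - \<rho>) *\<^sub>R sgn (x - c)"
  proof -
    have "x - c = norm (x - c) *\<^sub>R sgn (x - c)" using False by (simp add: sgn_div_norm)
    then show ?thesis by (simp add: y_def scaleR_diff_left)
  qed
  then have "dist x y = \<bar>norm (x - c) - \<rho>\<bar>" using False by (simp add: dist_norm norm_sgn)
  moreover have "dist c y = \<rho>" using False assms by (simp add: y_def dist_norm norm_sgn)
  ultimately show thesis using that by blast
qed

lemma frontier_shell:
  fixes c :: "'a::euclidean_space"
  assumes R: "0 < R" "ra < R" and ra: "ra \<noteq> 0"
  shows "frontier {x. ra < dist c x \<and> dist c x < R} = {x. dist c x = ra \<or> dist c x = R}"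
proof -
  define \<Omega> where "\<Omega> = {x. ra < dist c x \<and> dist c x < R}"
  have "open \<Omega>" unfolding \<Omega>_def by (intro open_Collect_conj open_Collect_less continuous_intros)
  then have fr: "frontier \<Omega> = closure \<Omega> - \<Omega>" by (simp add: frontier_def interior_open)
  have "closed {x. ra \<le> dist c x \<and> dist c x \<le> R}"
    by (intro closed_Collect_conj closed_Collect_le continuous_intros)
  then have cl: "closure \<Omega> \<subseteq> {x. ra \<le> dist c x \<and> dist c x \<le> R}"
    by (rule closure_minimal[rotated]) (auto simp: \<Omega>_def)
  have 1: "dist c x = ra \<or> dist c x = R" if "x \<in> frontier \<Omega>" for x
  proof -
    have "ra \<le> dist c x \<and> dist c x \<le> R" using that cl fr by blast
    moreover have "\<not> (ra < dist c x \<and> dist c x < R)" using that fr by (simp add: \<Omega>_def)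
    ultimately show ?thesis by linarith
  qed
  have "x \<in> closure \<Omega>" if x: "dist c x = ra \<or> dist c x = R" for x
    unfolding closure_approachable
  proof (intro allI impI)
    fix e :: real assume "e > 0"
    define s where "s = min e (min R (R - ra)) / 2"
    have s: "0 < s" "s < e" "s < R" "s < R - ra" using \<open>e > 0\<close> R by (auto simp: s_def)
    \<comment> \<open>Move by \<open>s\<close> into the shell. If \<open>dist c x = ra\<close>, then
      \<open>ra\<close> is nonnegative, so \<open>ra + s\<close> is a genuine radius.\<close>
    define \<rho> where "\<rho> = (if dist c x = R then R - s else ra + s)"
    have \<rho>: "0 < \<rho>" "ra < \<rho>" "\<rho> < R" using x s by (auto simp: \<rho>_def intro: add_nonneg_pos)
    obtain y where y: "dist c y = \<rho>" "dist x y = \<bar>norm (x - c) - \<rho>\<bar>"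
      using exists_on_sphere_same_ray[OF \<rho>(1)] by blast
    have "\<bar>norm (x - c) - \<rho>\<bar> = s"
      using x s by (auto simp: \<rho>_def dist_norm norm_minus_commute)
    then show "\<exists>y\<in>\<Omega>. dist y x < e" using y \<rho> s by (intro bexI[of _ y]) (auto simp: \<Omega>_def dist_commute)
  qed
  moreover have "x \<notin> \<Omega>" if "dist c x = ra \<or> dist c x = R" for x using that by (auto simp: \<Omega>_def)
  ultimately have "frontier \<Omega> = {x. dist c x = ra \<or> dist c x = R}" using 1 fr by blast
  then show ?thesis by (simp add: \<Omega>_def)
qed

lemma C1_closure_gradient:
  assumes "bounded \<Omega>" "C1_closure \<Omega> f"
  obtains L where "0 \<le> L" "\<And>x. x \<in> \<Omega> \<Longrightarrow> (f has_derivative (\<lambda>v. v \<bullet> grad f x)) (at x)"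
    "\<And>x. x \<in> \<Omega> \<Longrightarrow> norm (grad f x) \<le> L"
proof -
  obtain G where G: "continuous_on (closure \<Omega>) G" "\<And>x. x \<in> \<Omega> \<Longrightarrow> G x = grad f x"
    using assms(2) by (auto simp: C1_closure_def extends_continuously_def)
  have "bounded (G ` closure \<Omega>)"
    by (intro compact_imp_bounded compact_continuous_image[OF G(1)]) (simp add: compact_closure assms(1))
  then obtain L where L: "0 < L" "\<And>x. x \<in> closure \<Omega> \<Longrightarrow> norm (G x) \<le> L"
    unfolding bounded_pos by auto
  show thesis
  proof (rule that[of L])
    show "norm (grad f x) \<le> L" if "x \<in> \<Omega>" for x
      using L(2)[of x] G(2)[OF that] that closure_subset[of \<Omega>] by auto
    show "(f has_derivative (\<lambda>v. v \<bullet> grad f x)) (at x)" if "x \<in> \<Omega>" for x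
      using GDERIV_grad[of f x] assms(2) that by (simp add: C1_closure_def gderiv_def)
  qed (use L in simp)
qed

lemma classical_solution_viscous_hj:
  fixes \<Omega> :: "'a::euclidean_space set"
  assumes p: "p > 2" and \<Omega>: "open \<Omega>" "bounded \<Omega>"
    and h: "C1_closure \<Omega> h" "\<forall>x\<in>closure \<Omega>. 0 \<le> h x"
    and u0: "u0 \<in> initial_data \<Omega>" and u: "classical_solution p \<Omega> h u0 (ereal T) u"
  obtains Lh K0 where "viscous_hj p T Lh K0 \<Omega> h u (grad h) (\<lambda>x t. grad (\<lambda>y. u y t) x)
    (\<lambda>x t. frechet_derivative (grad (\<lambda>y. u y t)) (at x)) (\<lambda>x t. deriv (u x) t)"
proof -
  obtain Lh where Lh: "0 \<le> Lh" "\<And>x. x \<in> \<Omega> \<Longrightarrow> (h has_derivative (\<lambda>v. v \<bullet> grad h x)) (at x)"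
    "\<And>x. x \<in> \<Omega> \<Longrightarrow> norm (grad h x) \<le> Lh"
    using C1_closure_gradient[OF \<Omega>(2) h(1)] by blast
  have "C1_closure \<Omega> u0" using u0 by (simp add: initial_data_def)
  then obtain K0 where K0: "0 \<le> K0" "\<And>x. x \<in> \<Omega> \<Longrightarrow> (u0 has_derivative (\<lambda>v. v \<bullet> grad u0 x)) (at x)"
    "\<And>x. x \<in> \<Omega> \<Longrightarrow> norm (grad u0 x) \<le> K0"
    using C1_closure_gradient[OF \<Omega>(2)] by blast
  have I: "{t. 0 \<le> t \<and> ereal t < ereal T} = {0..<T}" "{t. 0 < t \<and> ereal t < ereal T} = {0<..<T}" by auto
  have T: "0 < T" and C21: "C21_closure \<Omega> {0<..<T} u" and C10: "C10_closure \<Omega> {0..<T} u"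
    and pde: "\<And>x t. x \<in> \<Omega> \<Longrightarrow> 0 < t \<Longrightarrow> t < T \<Longrightarrow>
        deriv (u x) t - laplacian (\<lambda>y. u y t) x = norm (grad (\<lambda>y. u y t) x) powr p + h x"
    and bc: "\<And>x t. x \<in> frontier \<Omega> \<Longrightarrow> 0 < t \<Longrightarrow> t < T \<Longrightarrow> u x t = 0"
    and ic: "\<And>x. x \<in> \<Omega> \<Longrightarrow> u x 0 = u0 x"
    using u unfolding classical_solution_def I by auto
  have gr: "((\<lambda>y. u y t) has_derivative (\<lambda>v. v \<bullet> grad (\<lambda>y. u y t) x)) (at x)"
    if "x \<in> \<Omega>" "0 \<le> t" "t < T" for x t
    using GDERIV_grad[of "\<lambda>y. u y t" x] C10 that by (simp add: C10_closure_def gderiv_def)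
  \<comment> \<open>The initial condition is given on the open set \<Omega> only, which suffices to
    identify the gradients there.\<close>
  have g0: "grad (\<lambda>y. u y 0) x = grad u0 x" if x: "x \<in> \<Omega>" for x
  proof (rule grad_eqI)
    show "GDERIV (\<lambda>y. u y 0) x :> grad u0 x" unfolding gderiv_def
      by (rule has_derivative_transform_within_open[OF K0(2)[OF x] \<Omega>(1) x]) (simp add: ic)
  qed
  have "viscous_hj p T Lh K0 \<Omega> h u (grad h) (\<lambda>x t. grad (\<lambda>y. u y t) x)
    (\<lambda>x t. frechet_derivative (grad (\<lambda>y. u y t)) (at x)) (\<lambda>x t. deriv (u x) t)"
  proof
    show "continuous_on (closure \<Omega> \<times> {0..<T}) (\<lambda>(x, t). u x t)"
      "extends_continuously (\<lambda>(x, t). grad (\<lambda>y. u y t) x) (\<Omega> \<times> {0..<T}) (closure \<Omega> \<times> {0..<T})"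
      using C10 by (simp_all add: C10_closure_def)
    fix x assume x: "x \<in> \<Omega>"
    show "0 \<le> h x" using h(2) x closure_subset[of \<Omega>] by auto
    show "0 \<le> u x 0" using u0 x ic closure_subset[of \<Omega>] by (auto simp: initial_data_def)
    show "norm (grad (\<lambda>y. u y 0) x) \<le> K0" using K0(3)[OF x] g0[OF x] by simp
    fix t assume t: "0 < t" "t < T"
    have "grad (\<lambda>y. u y t) differentiable (at x)" using C21 x t by (simp add: C21_closure_def)
    then show "(grad (\<lambda>y. u y t) has_derivative frechet_derivative (grad (\<lambda>y. u y t)) (at x)) (at x)"
      by (simp add: frechet_derivative_works)
    have "u x differentiable (at t)" using C21 x t by (simp add: C21_closure_def)
    then show "(u x has_real_derivative deriv (u x) t) (at t)"
      by (simp add: DERIV_deriv_iff_real_differentiable)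
    show "deriv (u x) t = (\<Sum>b\<in>Basis. frechet_derivative (grad (\<lambda>y. u y t)) (at x) b \<bullet> b)
        + norm (grad (\<lambda>y. u y t) x) powr p + h x"
      using pde[OF x t] by (simp add: laplacian_def)
  qed (use p T \<Omega> Lh K0 bc gr in auto)
  then show thesis by (rule that)
qed

lemma ball_or_annulus_shell:
  fixes \<Omega> :: "'a::euclidean_space set"
  assumes "(\<exists>c R. 0 < R \<and> \<Omega> = ball c R) \<or> annular_domain \<Omega>"
  obtains c ra R s0 \<rho>0 where "\<Omega> = {x. ra < dist c x \<and> dist c x < R}" "0 < R" "ra < R" "0 < \<rho>0" "0 < s0"
    "0 < ra \<or> ra = - R" "0 < ra \<or> ra \<le> - s0"
    "\<And>x. x \<in> \<Omega> \<Longrightarrow> dist c x < \<rho>0 \<Longrightarrow> s0 < R - dist c x \<and> s0 < dist c x - ra"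
  using assms
proof
  assume "\<exists>c R. 0 < R \<and> \<Omega> = ball c R"
  then obtain c R where c: "0 < R" "\<Omega> = ball c R" by blast
  have "- R < dist c x" for x using c(1) zero_le_dist[of c x] by linarith
  then have "\<Omega> = {x. - R < dist c x \<and> dist c x < R}" using c(2) by auto
  moreover have "R / 2 < R - dist c x \<and> R / 2 < dist c x - - R" if "dist c x < R / 2" for x
    using that c(1) zero_le_dist[of c x] by linarith
  \<comment> \<open>For a ball, points within \<open>R / 2\<close> of the centre are farther than
    \<open>R / 2\<close> from the sphere and from the fictitious radius \<open>- R\<close>.\<close>
  ultimately show thesis using that[of "- R" c R "R / 2" "R / 2"] c(1) by auto
next
  assume "annular_domain \<Omega>"
  then obtain c r R where "0 < r" "r < R" "\<Omega> = {x. r < dist c x \<and> dist c x < R}"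
    unfolding annular_domain_def by blast
  \<comment> \<open>With \<open>\<rho>0 = r\<close> the core of an annulus is empty, so any positive
    \<open>s0\<close> serves.\<close>
  then show thesis using that[of r c R r 1] by auto
qed

theorem theorem3p2:
  fixes p :: real and \<Omega> :: "'a::euclidean_space set"
    and h u0 :: "'a \<Rightarrow> real" and u :: "'a \<Rightarrow> real \<Rightarrow> real" and T :: ereal
  assumes "p > 2"
    and "(\<exists>c R. 0 < R \<and> \<Omega> = ball c R) \<or> annular_domain \<Omega>"
    and "C1_closure \<Omega> h" and "\<forall>x\<in>closure \<Omega>. 0 \<le> h x"
    and "u0 \<in> initial_data \<Omega>"
    and "maximal_classical_solution p \<Omega> h u0 T u"
    and "T < \<infinity>"
  defines "\<beta> \<equiv> 1 / (p - 1)"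
    and "d\<^sub>p \<equiv> (p - 1) powr (- 1 / (p - 1))"
    and "d \<equiv> (\<lambda>x. infdist x (frontier \<Omega>))"
  shows "\<forall>\<alpha>. 0 < \<alpha> \<and> \<alpha> < \<beta> / 2 \<longrightarrow>
    (\<exists>C>0. \<forall>x\<in>\<Omega>. \<forall>t. 0 < t \<and> ereal t < T \<longrightarrow>
       norm (grad (\<lambda>y. u y t) x) \<le> d x powr (- \<beta>) * (d\<^sub>p + C * d x powr \<alpha>))"
proof (intro allI impI)
  fix \<alpha> assume \<alpha>: "0 < \<alpha> \<and> \<alpha> < \<beta> / 2"
  have u: "classical_solution p \<Omega> h u0 T u"
    using assms(6) by (simp add: maximal_classical_solution_def)
  then have "0 < T" by (simp add: classical_solution_def)
  then obtain Tr where T_eq: "T = ereal Tr" using \<open>T < \<infinity>\<close> by (cases T) auto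
  obtain c ra R s0 \<rho>0 where \<Omega>: "\<Omega> = {x. ra < dist c x \<and> dist c x < R}" and R: "0 < R" "ra < R"
    and "0 < \<rho>0" "0 < s0" and inner: "0 < ra \<or> ra = - R" "0 < ra \<or> ra \<le> - s0"
    and core: "\<And>x. x \<in> \<Omega> \<Longrightarrow> dist c x < \<rho>0 \<Longrightarrow> s0 < R - dist c x \<and> s0 < dist c x - ra"
    by (rule ball_or_annulus_shell[OF assms(2)]) (rule that, assumption+)
  have fr: "frontier \<Omega> = {x. dist c x = ra \<or> dist c x = R}"
    unfolding \<Omega> by (rule frontier_shell) (use R inner in auto)
  have "open \<Omega>" unfolding \<Omega> by (intro open_Collect_conj open_Collect_less continuous_intros)
  have "bounded \<Omega>" by (rule bounded_subset[of "ball c R"]) (auto simp: \<Omega>)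
  obtain Lh K0 where vh: "viscous_hj p Tr Lh K0 \<Omega> h u (grad h) (\<lambda>x t. grad (\<lambda>y. u y t) x)
    (\<lambda>x t. frechet_derivative (grad (\<lambda>y. u y t)) (at x)) (\<lambda>x t. deriv (u x) t)"
    using classical_solution_viscous_hj[OF \<open>p > 2\<close> \<open>open \<Omega>\<close> \<open>bounded \<Omega>\<close> assms(3,4,5) u[unfolded T_eq]] by blast
  interpret annular_hj p Tr Lh K0 \<Omega> h u "grad h" "\<lambda>x t. grad (\<lambda>y. u y t) x"
    "\<lambda>x t. frechet_derivative (grad (\<lambda>y. u y t)) (at x)" "\<lambda>x t. deriv (u x) t" c ra R s0 \<rho>0
    by (intro annular_hj.intro vh annular_hj_axioms.intro \<Omega> fr R inner core \<open>0 < \<rho>0\<close> \<open>0 < s0\<close>)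
  obtain C0 F F' F'' where prof: "C0 \<ge> 0"
    "\<And>s. s > 0 \<Longrightarrow> (F has_real_derivative F' s) (at s)"
    "\<And>s. s > 0 \<Longrightarrow> (F' has_real_derivative F'' s) (at s)"
    "continuous_on {0<..} F''"
    "\<And>s. s > 0 \<Longrightarrow> 0 \<le> F s"
    "\<And>s. s > 0 \<Longrightarrow> F' s \<le> 0"
    "\<And>s. s > 0 \<Longrightarrow> F'' s \<le> p * (F s + C0) powr (p - 1) * (C0 - F' s)"
    "\<And>s. s > 0 \<Longrightarrow> F s \<le> d\<^sub>p * s powr (- \<beta>)"
    "\<And>s. s > 0 \<Longrightarrow> d\<^sub>p * s powr (- \<beta>) \<le> F s + C0"
    "\<And>s. s \<ge> s0 \<Longrightarrow> F s = 0"
    by (rule barrier_profile[OF \<open>p > 2\<close> \<open>0 < s0\<close>, folded d\<^sub>p_def \<beta>_def]) (rule that, assumption+)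
  have dp: "d\<^sub>p > 0" and \<beta>: "\<beta> > 0" using \<open>p > 2\<close> by (auto simp: d\<^sub>p_def \<beta>_def)
  define M where "M = C0 + 2 * K1 + K0 + DIM('a) / \<rho>0 + Lh + 2"
  define A where "A = max (max C0 1) (M / R)"
  have "M / R * R \<le> A * R" using R by (intro mult_right_mono) (auto simp: A_def)
  then have A: "C0 \<le> A" "1 \<le> A" "M \<le> A * R" using R by (auto simp: A_def)
  interpret hj_barrier p Tr Lh K0 \<Omega> h u "grad h" "\<lambda>x t. grad (\<lambda>y. u y t) x"
    "\<lambda>x t. frechet_derivative (grad (\<lambda>y. u y t)) (at x)" "\<lambda>x t. deriv (u x) t" c ra R s0 \<rho>0
    d\<^sub>p \<beta> C0 A F F' F''
    by unfold_locales (use prof dp \<beta> A in \<open>auto simp: M_def\<close>)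
  \<comment> \<open>One inequality suffices because the profile bound decreases in the distance. For
    a ball and \<open>i = 1\<close>, \<open>bdist\<close> is \<open>norm (x - c) + R\<close>, which
    exceeds the distance to the sphere.\<close>
  have d_le: "d x \<le> bdist i x" if "x \<in> \<Omega>" "i \<in> {-1, 1}" for x i
  proof -
    have *: "d x \<le> \<bar>norm (x - c) - \<rho>\<bar>" if "0 < \<rho>" "\<rho> = ra \<or> \<rho> = R" for \<rho>
    proof -
      obtain y where y: "dist c y = \<rho>" "dist x y = \<bar>norm (x - c) - \<rho>\<bar>"
        using exists_on_sphere_same_ray[OF \<open>0 < \<rho>\<close>] by blast
      then have "y \<in> frontier \<Omega>" using that by (auto simp: fr)
      then show ?thesis using infdist_le[of y "frontier \<Omega>" x] y by (simp add: d_def)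
    qed
    define r where "r = norm (x - c)"
    have "0 \<le> r" by (simp add: r_def)
    then show ?thesis using *[of R] *[of ra] R inner(1) that
      by (auto simp: bdist_def in_\<Omega> r_def[symmetric])
  qed
  have d_pos: "0 < d x" if "x \<in> \<Omega>" for x
  proof -
    obtain y where "dist c y = R" using exists_on_sphere_same_ray[OF R(1)] by blast
    then have ne: "frontier \<Omega> \<noteq> {}" by (auto simp: fr)
    have "x \<notin> frontier \<Omega>"
      using that \<open>open \<Omega>\<close> by (simp add: frontier_def interior_open)
    then have "d x \<noteq> 0" unfolding d_def using in_closed_iff_infdist_zero[OF frontier_closed ne] by blast
    then show ?thesis using infdist_nonneg[of x "frontier \<Omega>"] by (simp add: d_def)
  qed
  have d_R: "d x \<le> R" if "x \<in> \<Omega>" for x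
    using d_le[OF that, of "-1"] order_trans[of "d x" "R - norm (x - c)" R] by (simp add: bdist_def)
  \<comment> \<open>Since \<open>d x \<le> R\<close> and \<alpha> < \<beta>, the factor
    \<open>R powr (\<beta> - \<alpha>) * d x powr (\<alpha> - \<beta>)\<close> is at least one,
    which absorbs the constant \<open>3 * A * R\<close>.\<close>
  define C where "C = 3 * A * R * R powr (\<beta> - \<alpha>)"
  show "\<exists>C>0. \<forall>x\<in>\<Omega>. \<forall>t. 0 < t \<and> ereal t < T \<longrightarrow>
       norm (grad (\<lambda>y. u y t) x) \<le> d x powr (- \<beta>) * (d\<^sub>p + C * d x powr \<alpha>)"
  proof (intro exI[of _ C] conjI ballI allI impI)
    show "0 < C" using A(2) R by (simp add: C_def)
    fix x t assume x: "x \<in> \<Omega>" and t: "0 < t \<and> ereal t < T"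
    obtain i where i: "i \<in> {-1, 1}" "norm (grad (\<lambda>y. u y t) x) \<le> 3 * A * R + F (bdist i x)"
      using gradient_le_barrier[OF x, of t] t by (auto simp: T_eq)
    have "F (bdist i x) \<le> d\<^sub>p * bdist i x powr (- \<beta>)" by (rule prof(8)[OF bdist_pos[OF x]])
    also have "\<dots> \<le> d\<^sub>p * d x powr (- \<beta>)"
      using d_le[OF x i(1)] d_pos[OF x] dp \<beta> by (intro mult_left_mono powr_mono2') auto
    finally have 1: "F (bdist i x) \<le> d\<^sub>p * d x powr (- \<beta>)" .
    have "d x powr (\<beta> - \<alpha>) \<le> R powr (\<beta> - \<alpha>)"
      using d_R[OF x] d_pos[OF x] \<alpha> \<beta> by (intro powr_mono2) auto
    then have "d x powr (\<beta> - \<alpha>) * d x powr (\<alpha> - \<beta>) \<le> R powr (\<beta> - \<alpha>) * d x powr (\<alpha> - \<beta>)"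
      by (intro mult_right_mono) auto
    then have "1 \<le> R powr (\<beta> - \<alpha>) * d x powr (\<alpha> - \<beta>)"
      using d_pos[OF x] by (simp add: powr_add[symmetric])
    then have "3 * A * R * 1 \<le> 3 * A * R * (R powr (\<beta> - \<alpha>) * d x powr (\<alpha> - \<beta>))"
      using A(2) R by (intro mult_left_mono) auto
    also have "d x powr (\<alpha> - \<beta>) = d x powr (- \<beta>) * d x powr \<alpha>"
      by (simp add: powr_add[symmetric])
    finally have 2: "3 * A * R \<le> d x powr (- \<beta>) * (C * d x powr \<alpha>)" by (simp add: C_def mult_ac)
    show "norm (grad (\<lambda>y. u y t) x) \<le> d x powr (- \<beta>) * (d\<^sub>p + C * d x powr \<alpha>)"
      using i(2) 1 2 by (simp add: distrib_left mult.commute)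
  qed
qed

end
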